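(* Let $n\ge 1$ and let $f$ be a probability density on $\mathbb{R}^n_+=(0,\infty)^n$ that is MVHCM (multivariate hyperbolically completely monotone). Then its Laplace transform $$F(s_1,\dots,s_n)=\int_{\mathbb{R}^n_+} e^{-(s_1x_1+\cdots+s_nx_n)}f(x_1,\dots,x_n)\,dx_1\cdots dx_n,\qquad (s_1,\dots,s_n)\in\mathbb{R}^n_+,$$ is also MVHCM as a function on $\mathbb{R}^n_+$.
   Context: A function $\Phi$ on $(0,\infty)^m$ is completely monotone (CM) if it is $C^\infty$ and $(-1)^{|\alpha|}D^\alpha\Phi\ge 0$ for all multi-indices $\alpha$; by Bernstein's theorem such functions are the Laplace transforms of nonnegative measures. A nonnegative function $f$ on $\mathbb{R}^n_+=(0,\infty)^n$ is MVHCM if for all fixed $u_1,\dots,u_n>0$ the product $$f(u_1v_1,\dots,u_nv_n)\cdot f(u_1/v_1,\dots,u_n/v_n)$$ is completely monotone as a function of the variables $w_i=v_i+1/v_i$ $(1\le i\le n)$ and $w_{ij}=v_i/v_j+v_j/v_i$ $(1\le i<j\le n)$. This means: for all fixed $u_1,\dots,u_n>0$ there is a nonnegative Borel measure $\nu$ (depending on $u_1,\dots,u_n$) on $[0,\infty)^{n+\binom n2}$ such that for all $v_1,\dots,v_n>0$ $$f(u_1v_1,\dots,u_nv_n)\, f(u_1/v_1,\dots,u_n/v_n)=\int \exp\Big(-\sum_{i}\lambda_iw_i-\sum_{i<j}\lambda_{ij}w_{ij}\Big)\,d\nu(\lambda).$$ *)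

theory Defs
  imports "HOL-Analysis.Analysis"
begin

text \<open>
  The index type of the coordinates is finite and linearly ordered; the order serves only to list
  each pair of distinct coordinates once, as a pair \<open>i < j\<close>.
\<close>

definition pos_orthant :: "(real ^ 'n) set" where
  "pos_orthant = {x. \<forall>i. 0 < x $ i}"

definition index_pairs :: "('n::{finite,linorder} \<times> 'n) set" where
  "index_pairs = {(i, j). i < j}"

text \<open>
  The Borel space \<open>[0,\<infinity>)\<close> to the power \<open>n + (n choose 2)\<close>. A point is a pair \<open>(l, m)\<close>: \<open>l i\<close> is
  the variable dual to \<open>v i + 1 / v i\<close> and \<open>m (i, j)\<close> the one dual to
  \<open>v i / v j + v j / v i\<close>, for \<open>i < j\<close>. Only the sigma-algebra is used below.
\<close>

definition dual_space :: "(('n::{finite,linorder} \<Rightarrow> real) \<times> ('n \<times> 'n \<Rightarrow> real)) measure" where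
  "dual_space =
     (\<Pi>\<^sub>M i\<in>UNIV. restrict_space borel {0..}) \<Otimes>\<^sub>M (\<Pi>\<^sub>M p\<in>index_pairs. restrict_space borel {0..})"

definition hyp_kernel ::
  "real ^ 'n::{finite,linorder} \<Rightarrow> ('n \<Rightarrow> real) \<times> ('n \<times> 'n \<Rightarrow> real) \<Rightarrow> real" where
  "hyp_kernel v = (\<lambda>(l, m).
     exp (- (\<Sum>i\<in>UNIV. l i * (v $ i + 1 / v $ i))
          - (\<Sum>(i, j)\<in>index_pairs. m (i, j) * (v $ i / v $ j + v $ j / v $ i))))"

text \<open>
  The measure \<open>\<nu>\<close> depends on \<open>u\<close> but not on \<open>v\<close>, and need not be finite. Using
  \<open>has_bochner_integral\<close> rather than an equation between integrals makes the finiteness of the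
  integral part of the condition. Values of \<open>f\<close> outside the open orthant are irrelevant.
\<close>

definition mvhcm :: "(real ^ 'n::{finite,linorder} \<Rightarrow> real) \<Rightarrow> bool" where
  "mvhcm f \<longleftrightarrow>
     (\<forall>x\<in>pos_orthant. 0 \<le> f x) \<and>
     (\<forall>u\<in>pos_orthant. \<exists>\<nu>. sets \<nu> = sets dual_space \<and>
        (\<forall>v\<in>pos_orthant.
           has_bochner_integral \<nu> (hyp_kernel v)
             (f (\<chi> i. u $ i * v $ i) * f (\<chi> i. u $ i / v $ i))))"

definition prob_density_on_orthant :: "(real ^ 'n \<Rightarrow> real) \<Rightarrow> bool" where
  "prob_density_on_orthant f \<longleftrightarrow>
     (\<forall>x\<in>pos_orthant. 0 \<le> f x) \<and>
     set_integrable lborel pos_orthant f \<and>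
     (LINT x:pos_orthant|lborel. f x) = 1"

definition laplace_transform :: "(real ^ 'n \<Rightarrow> real) \<Rightarrow> real ^ 'n \<Rightarrow> real" where
  "laplace_transform f s =
     (LINT x:pos_orthant|lborel. exp (- (\<Sum>i\<in>UNIV. s $ i * x $ i)) * f x)"

end

theory Submission
  imports Defs "HOL-Probability.Probability"
begin

text \<open>
  Substitute \<open>x = exp (c + h)\<close>, \<open>y = exp (c - h)\<close> in the double integral for \<open>F (u v) F (u / v)\<close>. For
  fixed \<open>c\<close>, the hypothesis writes \<open>f (exp (c + h)) f (exp (c - h))\<close> as a mixture of exponentials of
  \<open>- l i (2 cosh (h i))\<close> and \<open>- m (i, j) (2 cosh (h i - h j))\<close>, while the two Laplace kernels contribute
  \<open>- 2 u i exp (c i) cosh (h i + ln (v i))\<close>. So the exponent is an energy \<open>\<Sum> c a b cosh (p a - p b)\<close>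
  with nonnegative weights on a complete graph whose vertices are the \<open>h i\<close>, the \<open>- ln (v i)\<close> and \<open>0\<close>.
  By \<open>\<integral> exp (- A e\<^sup>h - B e\<^sup>-\<^sup>h) dh = \<integral> exp (- A B e\<^sup>t - e\<^sup>-\<^sup>t) dt\<close>, integrating out one vertex
  yields a mixture of energies of the same kind on the remaining vertices, and once all \<open>h i\<close> are gone
  only the variables \<open>v i + 1 / v i\<close> and \<open>v i / v j + v j / v i\<close> are left.

  The representing measures of \<open>f\<close> are not unique and need not depend measurably on \<open>c\<close>, so
  the mixtures cannot be formed naively. Instead a mixture of representable functions is shown to be
  representable by weak compactness. Helly's theorem is only available on the line, so the
  measures are transported to \<open>[0, 1]\<close> by a measurable section of a space-filling curve.
\<close>

subsection \<open>A space-filling curve with a measurable section\<close>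

text \<open>
  Schoenberg's curve in countably many coordinates. Since \<open>tooth\<close> has period \<open>2\<close>, vanishes on
  \<open>[0, 1/3]\<close> and equals \<open>1\<close> on \<open>[2/3, 1]\<close>, it reads off one digit of a ternary expansion with digits
  \<open>0\<close> and \<open>2\<close>.
\<close>

definition tooth :: "real \<Rightarrow> real" where
  "tooth t = max 0 (min 1 (1 / 2 - cos (pi * t)))"

definition schoenberg :: "nat \<Rightarrow> real \<Rightarrow> real" where
  "schoenberg m t = (\<Sum>k. tooth (3 ^ prod_encode (m, k) * t) / 2 ^ Suc k)"

text \<open>
  Ceilings instead of floors give the expansion of \<open>x \<in> (0, 1]\<close> that does not terminate, so that
  \<open>x = 1\<close> is covered; \<open>x = 0\<close> is not.
\<close>

definition bin_digit :: "nat \<Rightarrow> real \<Rightarrow> real" where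
  "bin_digit k x = of_int (\<lceil>2 ^ Suc k * x\<rceil> - 2 * \<lceil>2 ^ k * x\<rceil> + 1)"

definition ternary_code :: "(nat \<Rightarrow> real) \<Rightarrow> real" where
  "ternary_code d = (\<Sum>j. 2 * d j / 3 ^ Suc j)"

definition schoenberg_section :: "(nat \<Rightarrow> real) \<Rightarrow> real" where
  "schoenberg_section x =
     ternary_code (\<lambda>j. case prod_decode j of (m, k) \<Rightarrow> bin_digit k (x m))"

lemma tooth_range: "0 \<le> tooth t" "tooth t \<le> 1"
  by (auto simp: tooth_def)

lemma continuous_on_tooth [continuous_intros]:
  fixes g :: "'a::t2_space \<Rightarrow> real"
  shows "continuous_on A g \<Longrightarrow> continuous_on A (\<lambda>x. tooth (g x))"
  unfolding tooth_def by (intro continuous_intros)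

lemma tooth_periodic: "tooth (t + 2 * of_nat n) = tooth t"
proof -
  have "pi * (t + 2 * of_nat n) = pi * t + 2 * of_nat n * pi"
    by (simp add: algebra_simps)
  then show ?thesis
    unfolding tooth_def by (simp add: cos_add)
qed

lemma tooth_low:
  assumes "0 \<le> t" "t \<le> 1 / 3"
  shows "tooth t = 0"
proof -
  have "cos (pi / 3) \<le> cos (pi * t)"
    using assms by (intro cos_monotone_0_pi_le) (auto simp: field_simps)
  then show ?thesis
    by (simp add: tooth_def cos_60)
qed

lemma tooth_high:
  assumes "2 / 3 \<le> t" "t \<le> 1"
  shows "tooth t = 1"
proof -
  have "cos (pi * t) \<le> cos (2 * pi / 3)"
    using assms by (intro cos_monotone_0_pi_le) (auto simp: field_simps)
  then show ?thesis
    by (simp add: tooth_def cos_120)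
qed

lemma summable_half_powers: "summable (\<lambda>k. 1 / 2 ^ Suc k :: real)"
  using power_half_series by (simp add: power_divide sums_iff)

lemma suminf_half_powers: "(\<Sum>k. 1 / 2 ^ Suc k) = (1 :: real)"
  using power_half_series by (simp add: power_divide sums_iff)

lemma summable_schoenberg: "summable (\<lambda>k. tooth (f k) / 2 ^ Suc k)"
  by (rule summable_comparison_test'[OF summable_half_powers, of 0])
     (simp add: tooth_range divide_right_mono)

lemma schoenberg_range: "0 \<le> schoenberg m t" "schoenberg m t \<le> 1"
proof -
  show "0 \<le> schoenberg m t"
    unfolding schoenberg_def by (intro suminf_nonneg summable_schoenberg) (simp add: tooth_range)
  have "schoenberg m t \<le> (\<Sum>k. 1 / 2 ^ Suc k)"
    unfolding schoenberg_def
    by (intro suminf_le summable_schoenberg summable_half_powers divide_right_mono tooth_range) simp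
  then show "schoenberg m t \<le> 1" by (simp only: suminf_half_powers)
qed

lemma continuous_on_schoenberg: "continuous_on UNIV (schoenberg m)"
proof -
  have "uniform_limit UNIV (\<lambda>n t. \<Sum>k<n. tooth (3 ^ prod_encode (m, k) * t) / 2 ^ Suc k)
      (\<lambda>t. \<Sum>k. tooth (3 ^ prod_encode (m, k) * t) / 2 ^ Suc k) sequentially"
    by (rule Weierstrass_m_test[OF _ summable_half_powers])
       (simp add: tooth_range divide_right_mono)
  then have "continuous_on UNIV (\<lambda>t. \<Sum>k. tooth (3 ^ prod_encode (m, k) * t) / 2 ^ Suc k)"
    by (rule uniform_limit_theorem[rotated])
       (auto intro!: always_eventually continuous_intros)
  then show ?thesis unfolding schoenberg_def[abs_def] .
qed

lemma bin_digit_cases: "bin_digit k x = 0 \<or> bin_digit k x = 1"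
proof -
  define y where "y = 2 ^ k * x"
  have "\<lceil>2 * y\<rceil> = 2 * \<lceil>y\<rceil> \<or> \<lceil>2 * y\<rceil> = 2 * \<lceil>y\<rceil> - 1"
    by linarith
  then show ?thesis
    unfolding bin_digit_def by (auto simp: y_def mult.assoc)
qed

text \<open>The series telescopes along \<open>A k\<close>, the largest multiple of
  \<open>1 / 2 ^ k\<close> strictly below \<open>x\<close>. The bounds on \<open>x\<close> give
  \<open>A 0 = 0\<close>.\<close>

lemma bin_digit_sums:
  assumes "0 < x" "x \<le> 1"
  shows "(\<lambda>k. bin_digit k x / 2 ^ Suc k) sums x"
proof -
  define A :: "nat \<Rightarrow> real" where "A k = (of_int \<lceil>2 ^ k * x\<rceil> - 1) / 2 ^ k" for k
  have "\<lceil>x\<rceil> = 1"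
    using assms by (simp add: ceiling_eq_iff)
  then have "A 0 = 0"
    by (simp add: A_def)
  have "bin_digit k x / 2 ^ Suc k = A (Suc k) - A k" for k
    by (simp add: bin_digit_def A_def field_simps)
  moreover have "(\<lambda>k. A (Suc k) - A k) sums (x - A 0)"
  proof (rule telescope_sums)
    show "A \<longlonglongrightarrow> x"
    proof (rule tendsto_sandwich[where f="\<lambda>k. x - (1 / 2) ^ k" and h="\<lambda>k. x"])
      have "x - (1 / 2) ^ k \<le> A k \<and> A k \<le> x" for k
      proof -
        have "2 ^ k * x - 1 \<le> of_int \<lceil>2 ^ k * x\<rceil> - 1 \<and> of_int \<lceil>2 ^ k * x\<rceil> - 1 \<le> 2 ^ k * x"
          by linarith
        then show ?thesis by (simp add: A_def field_simps)
      qed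
      then show "\<forall>\<^sub>F k in sequentially. x - (1 / 2) ^ k \<le> A k"
        and "\<forall>\<^sub>F k in sequentially. A k \<le> x" by auto
      have "(\<lambda>k. x - (1 / 2) ^ k) \<longlonglongrightarrow> x - 0"
        by (intro tendsto_intros LIMSEQ_power_zero) simp
      then show "(\<lambda>k. x - (1 / 2) ^ k) \<longlonglongrightarrow> x" by simp
    qed simp
  qed
  ultimately show ?thesis using \<open>A 0 = 0\<close> by simp
qed

section \<open>Ternary expansions with digits 0 and 2\<close>

lemma third_powers_sums: "(\<lambda>j. 2 / 3 ^ Suc j :: real) sums 1"
  using sums_mult[OF geometric_sums[of "1 / 3 :: real"], of "2 / 3"]
  by (simp add: power_divide)

context
  fixes d :: "nat \<Rightarrow> real"
  assumes digit: "\<And>j. d j = 0 \<or> d j = 1"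
begin

lemma digit_range: "0 \<le> d j" "d j \<le> 1"
  using digit[of j] by auto

lemma summable_ternary_code: "summable (\<lambda>j. 2 * d j / 3 ^ Suc j)"
  by (rule summable_comparison_test'[OF sums_summable[OF third_powers_sums], of 0])
     (simp add: digit_range divide_right_mono)

lemma ternary_code_range: "0 \<le> ternary_code d" "ternary_code d \<le> 1"
proof -
  show "0 \<le> ternary_code d"
    unfolding ternary_code_def
    by (intro suminf_nonneg summable_ternary_code) (simp add: digit_range)
  have "ternary_code d \<le> (\<Sum>j. 2 / 3 ^ Suc j)"
    unfolding ternary_code_def
    by (intro suminf_le summable_ternary_code sums_summable[OF third_powers_sums] divide_right_mono)
       (auto simp: digit_range)
  then show "ternary_code d \<le> 1" using third_powers_sums by (simp only: sums_iff)
qed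

end

lemma ternary_code_Suc:
  assumes "\<And>j. d j = 0 \<or> d j = 1"
  shows "3 * ternary_code d = 2 * d 0 + ternary_code (\<lambda>j. d (Suc j))"
proof -
  have "ternary_code d = (\<Sum>j. 2 * d (Suc j) / 3 ^ Suc (Suc j)) + 2 * d 0 / 3 ^ Suc 0"
    unfolding ternary_code_def using suminf_split_head[OF summable_ternary_code[of d]] assms
    by (simp del: power_Suc)
  also have "(\<Sum>j. 2 * d (Suc j) / 3 ^ Suc (Suc j)) = ternary_code (\<lambda>j. d (Suc j)) / 3"
    unfolding ternary_code_def
    by (subst suminf_divide[symmetric]) (use summable_ternary_code[of "\<lambda>j. d (Suc j)"] assms in auto)
  finally show ?thesis by simp
qed

text \<open>Multiplication by \<open>3 ^ i\<close> moves \<open>i\<close> digits in front of the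
  ternary point. All of them are 0 or 2, so the integer they form is even, a multiple of the period
  of \<open>tooth\<close>.\<close>

lemma ternary_code_shift:
  assumes "\<And>j. d j = 0 \<or> d j = 1"
  shows "\<exists>n. 3 ^ i * ternary_code d = ternary_code (\<lambda>j. d (i + j)) + 2 * of_nat n"
proof (induction i)
  case 0
  show ?case by (auto intro: exI[of _ 0])
next
  case (Suc i)
  then obtain n where n: "3 ^ i * ternary_code d = ternary_code (\<lambda>j. d (i + j)) + 2 * of_nat n"
    by blast
  obtain b :: nat where b: "d i = of_nat b"
    using assms[of i] by (metis of_nat_0 of_nat_1)
  have "3 ^ Suc i * ternary_code d = 3 * (3 ^ i * ternary_code d)" by simp
  also have "\<dots> = 3 * ternary_code (\<lambda>j. d (i + j)) + 6 * of_nat n" unfolding n by simp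
  also have "3 * ternary_code (\<lambda>j. d (i + j)) = 2 * d i + ternary_code (\<lambda>j. d (Suc i + j))"
    using ternary_code_Suc[of "\<lambda>j. d (i + j)"] assms by simp
  finally have "3 ^ Suc i * ternary_code d
      = ternary_code (\<lambda>j. d (Suc i + j)) + 2 * of_nat (b + 3 * n)"
    using b by simp
  then show ?case by blast
qed

text \<open>Up to a multiple of the period only the tail with leading digit \<open>2 * d i\<close>
  is left. It lies in [0, 1/3] or in [2/3, 1], where \<open>tooth\<close> is constant.\<close>

lemma tooth_ternary_code:
  assumes "\<And>j. d j = 0 \<or> d j = 1"
  shows "tooth (3 ^ i * ternary_code d) = d i"
proof -
  obtain n where n: "3 ^ i * ternary_code d = ternary_code (\<lambda>j. d (i + j)) + 2 * of_nat n"
    using ternary_code_shift[of d, OF assms] by blast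
  have eq: "3 * ternary_code (\<lambda>j. d (i + j)) = 2 * d i + ternary_code (\<lambda>j. d (Suc (i + j)))"
    using ternary_code_Suc[of "\<lambda>j. d (i + j)"] assms by simp
  have r: "0 \<le> ternary_code (\<lambda>j. d (Suc (i + j)))" "ternary_code (\<lambda>j. d (Suc (i + j))) \<le> 1"
    using assms by (auto intro!: ternary_code_range)
  show ?thesis
    unfolding n tooth_periodic using assms[of i]
  proof
    assume "d i = 0"
    then show "tooth (ternary_code (\<lambda>j. d (i + j))) = d i"
      using eq r by (subst tooth_low) auto
  next
    assume "d i = 1"
    then show "tooth (ternary_code (\<lambda>j. d (i + j))) = d i"
      using eq r by (subst tooth_high) auto
  qed
qed

lemma section_digit_cases:
  "(case prod_decode j of (m, k) \<Rightarrow> bin_digit k (x m)) = 0 \<or>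
   (case prod_decode j of (m, k) \<Rightarrow> bin_digit k (x m)) = 1"
  using bin_digit_cases by (simp split: prod.split)

text \<open>Digit \<open>k\<close> of coordinate \<open>m\<close> is stored at position
  \<open>prod_encode (m, k)\<close>, exactly where \<open>schoenberg m\<close> reads its
  \<open>k\<close>-th binary digit. So one real number serves all coordinates at once.\<close>

lemma schoenberg_section:
  assumes "0 < x m" "x m \<le> 1"
  shows "schoenberg m (schoenberg_section x) = x m"
proof -
  have "tooth (3 ^ prod_encode (m, k) * schoenberg_section x) = bin_digit k (x m)" for k
    unfolding schoenberg_section_def by (subst tooth_ternary_code[OF section_digit_cases]) simp
  then show ?thesis
    unfolding schoenberg_def using bin_digit_sums[OF assms] by (simp add: sums_iff del: power_Suc)
qed

lemma schoenberg_section_range: "0 \<le> schoenberg_section x" "schoenberg_section x \<le> 1"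
  unfolding schoenberg_section_def by (rule ternary_code_range[OF section_digit_cases])+

lemma measurable_schoenberg_section [measurable]:
  assumes [measurable]: "\<And>m. (\<lambda>\<omega>. x \<omega> m) \<in> borel_measurable M"
  shows "(\<lambda>\<omega>. schoenberg_section (x \<omega>)) \<in> borel_measurable M"
proof -
  have [measurable]: "(\<lambda>\<omega>. bin_digit k (x \<omega> m)) \<in> borel_measurable M" for k m
    unfolding bin_digit_def by measurable
  show ?thesis
    unfolding schoenberg_section_def ternary_code_def case_prod_unfold by measurable
qed

subsection \<open>Mixtures of non-measurable families of measures\<close>

text \<open>
  No measurability of \<open>s \<mapsto> P s\<close> is available, only that of countably many integrals. So \<open>\<theta>\<close> is cut
  into the cells on which finitely many of these integrals are constant up to \<open>1 / n\<close>, and one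
  representative \<open>P s\<close> is chosen for each cell; compactness then allows \<open>n \<rightarrow> \<infinity>\<close>.
\<close>

lemma weak_mixture_finite:
  fixes P :: "'s \<Rightarrow> real measure" and \<phi> :: "nat \<Rightarrow> real \<Rightarrow> real"
  assumes \<theta>: "prob_space \<theta>"
    and P: "\<And>s. s \<in> space \<theta> \<Longrightarrow> real_distribution (P s)"
    and P01: "\<And>s. s \<in> space \<theta> \<Longrightarrow> emeasure (P s) {0..1} = 1"
    and \<phi>: "\<And>j. \<phi> j \<in> borel_measurable borel" "\<And>j t. 0 \<le> \<phi> j t" "\<And>j t. \<phi> j t \<le> 1"
    and meas: "\<And>j. (\<lambda>s. integral\<^sup>L (P s) (\<phi> j)) \<in> borel_measurable \<theta>"
    and n: "0 < n"
  shows "\<exists>Q. real_distribution Q \<and> emeasure Q {0..1} = 1 \<and>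
    (\<forall>j<n. \<bar>integral\<^sup>L Q (\<phi> j) - (\<integral>s. integral\<^sup>L (P s) (\<phi> j) \<partial>\<theta>)\<bar> \<le> 1 / real n)"
proof -
  interpret \<theta>: prob_space \<theta> by fact
  define g where "g s j = integral\<^sup>L (P s) (\<phi> j)" for s j
  have [measurable]: "(\<lambda>s. g s j) \<in> borel_measurable \<theta>" for j
    unfolding g_def by (rule meas)
  have g01: "0 \<le> g s j" "g s j \<le> 1" if "s \<in> space \<theta>" for s j
  proof -
    interpret real_distribution "P s" by (rule P[OF that])
    show "0 \<le> g s j" unfolding g_def using \<phi> by simp
    have "g s j \<le> (\<integral>x. 1 \<partial>P s)"
      unfolding g_def using \<phi>
      by (intro integral_mono integrable_const_bound[where B=1]) (auto cong: measurable_cong_sets)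
    also have "\<dots> \<le> 1" by simp
    finally show "g s j \<le> 1" .
  qed
  \<comment> \<open>Rounding finitely many integrals leaves countably many patterns; coding them by
    \<open>to_nat\<close> makes \<open>cell\<close> a map into a discrete space.\<close>
  define cell where "cell s = to_nat (map (\<lambda>j. \<lfloor>real n * g s j\<rfloor>) [0..<n])" for s
  define rep where "rep m = (SOME s. s \<in> space \<theta> \<and> (m \<in> cell ` space \<theta> \<longrightarrow> cell s = m))" for m
  have rep: "rep m \<in> space \<theta> \<and> (m \<in> cell ` space \<theta> \<longrightarrow> cell (rep m) = m)" for m
  proof -
    have "\<exists>s. s \<in> space \<theta> \<and> (m \<in> cell ` space \<theta> \<longrightarrow> cell s = m)"
    proof (cases "m \<in> cell ` space \<theta>")
      case True
      then show ?thesis by force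
    next
      case False
      then show ?thesis using \<theta>.not_empty by blast
    qed
    then show ?thesis unfolding rep_def by (rule someI_ex)
  qed
  have rep_in [simp]: "rep m \<in> space \<theta>" for m
    using rep by blast
  have Pr [simp]: "real_distribution (P (rep m))" for m
    using P rep_in by blast
  have near: "\<bar>g (rep (cell s)) j - g s j\<bar> \<le> 1 / n" if "s \<in> space \<theta>" "j < n" for s j
  proof -
    have "cell (rep (cell s)) = cell s" using rep that by blast
    then have "map (\<lambda>j. \<lfloor>real n * g (rep (cell s)) j\<rfloor>) [0..<n] = map (\<lambda>j. \<lfloor>real n * g s j\<rfloor>) [0..<n]"
      unfolding cell_def by simp
    then have "\<lfloor>real n * g (rep (cell s)) j\<rfloor> = \<lfloor>real n * g s j\<rfloor>"
      using that by simp
    then have "\<bar>real n * g (rep (cell s)) j - real n * g s j\<bar> \<le> 1" by linarith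
    then have "real n * \<bar>g (rep (cell s)) j - g s j\<bar> \<le> 1"
      by (simp add: abs_mult flip: right_diff_distrib)
    then show ?thesis using n by (simp add: field_simps)
  qed
  have cellm [measurable]: "cell \<in> measurable \<theta> (count_space UNIV)"
  proof -
    have 1: "(\<lambda>s. map (\<lambda>j. \<lfloor>real n * g s j\<rfloor>) xs) \<in> measurable \<theta> (count_space UNIV)" for xs
    proof (induction xs)
      case (Cons a xs)
      have [measurable]: "(\<lambda>s. map (\<lambda>j. \<lfloor>real n * g s j\<rfloor>) xs) \<in> measurable \<theta> (count_space UNIV)"
        by fact
      have "(\<lambda>s. \<lfloor>real n * g s a\<rfloor> # map (\<lambda>j. \<lfloor>real n * g s j\<rfloor>) xs) \<in> measurable \<theta> (count_space UNIV)"
        by measurable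
      then show ?case by simp
    qed simp
    show ?thesis unfolding cell_def using 1 by measurable
  qed
  define D where "D = distr \<theta> (count_space UNIV) cell"
  interpret D: prob_space D unfolding D_def by (rule \<theta>.prob_space_distr) measurable
  have sD [measurable_cong, simp]: "sets D = sets (count_space UNIV)" by (simp add: D_def)
  \<comment> \<open>On the discrete space \<open>D\<close> every family of distributions is a
    measurable kernel, so the representatives can be mixed even though \<open>P\<close> itself
    cannot.\<close>
  have Pm: "(\<lambda>m. P (rep m)) \<in> measurable D (subprob_algebra borel)"
  proof -
    have "P (rep m) \<in> space (subprob_algebra borel)" for m
      by (simp add: space_subprob_algebra real_distribution.axioms(1)[OF Pr]
          real_distribution.events_eq_borel[OF Pr] prob_space_imp_subprob_space)
    then show ?thesis by (simp add: measurable_def D_def)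
  qed
  define Q where "Q = D \<bind> (\<lambda>m. P (rep m))"
  have Qsets [simp]: "sets Q = sets borel"
    unfolding Q_def by (rule sets_bind) (simp_all add: real_distribution.events_eq_borel[OF Pr] D.not_empty)
  have "prob_space Q"
    unfolding Q_def
    by (rule D.prob_space_bind[OF _ Pm]) (simp add: real_distribution.axioms(1)[OF Pr])
  then have Q: "real_distribution Q"
    by (simp add: real_distribution_def real_distribution_axioms_def)
  interpret Q: real_distribution Q by fact
  have "emeasure Q {0..1} = (\<integral>\<^sup>+m. emeasure (P (rep m)) {0..1} \<partial>D)"
    unfolding Q_def by (rule emeasure_bind[OF D.not_empty Pm]) simp
  also have "\<dots> = (\<integral>\<^sup>+m. 1 \<partial>D)"
    by (intro nn_integral_cong) (simp add: P01)
  finally have Q01: "emeasure Q {0..1} = 1"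
    by (simp add: D.emeasure_space_1)
  have Qint: "integral\<^sup>L Q (\<phi> j) = (\<integral>s. g (rep (cell s)) j \<partial>\<theta>)" for j
  proof -
    have "ennreal (integral\<^sup>L Q (\<phi> j)) = (\<integral>\<^sup>+t. \<phi> j t \<partial>Q)"
      using \<phi> by (intro nn_integral_eq_integral[symmetric] Q.integrable_const_bound[where B=1])
        (auto cong: measurable_cong_sets)
    also have "\<dots> = (\<integral>\<^sup>+m. \<integral>\<^sup>+t. \<phi> j t \<partial>P (rep m) \<partial>D)"
      unfolding Q_def using \<phi> by (intro nn_integral_bind[OF _ Pm]) auto
    also have "\<dots> = (\<integral>\<^sup>+m. g (rep m) j \<partial>D)"
    proof (intro nn_integral_cong)
      fix m
      interpret R: real_distribution "P (rep m)" by (rule Pr)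
      show "(\<integral>\<^sup>+t. \<phi> j t \<partial>P (rep m)) = ennreal (g (rep m) j)"
        unfolding g_def using \<phi> by (intro nn_integral_eq_integral R.integrable_const_bound[where B=1])
        (auto cong: measurable_cong_sets)
    qed
    also have "\<dots> = (\<integral>\<^sup>+s. g (rep (cell s)) j \<partial>\<theta>)"
      unfolding D_def by (subst nn_integral_distr) auto
    also have "\<dots> = ennreal (\<integral>s. g (rep (cell s)) j \<partial>\<theta>)"
      using g01
      by (intro nn_integral_eq_integral \<theta>.integrable_const_bound[where B=1])
         (auto intro!: measurable_compose[OF cellm])
    finally show ?thesis
      using \<phi> g01 by (subst (asm) ennreal_inj) (auto intro!: integral_nonneg)
  qed
  have "\<bar>integral\<^sup>L Q (\<phi> j) - (\<integral>s. g s j \<partial>\<theta>)\<bar> \<le> 1 / n" if "j < n" for j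
  proof -
    have i1: "integrable \<theta> (\<lambda>s. g (rep (cell s)) j)"
      using g01 by (intro \<theta>.integrable_const_bound[where B=1])
         (auto intro!: measurable_compose[OF cellm])
    have i2: "integrable \<theta> (\<lambda>s. g s j)"
      using g01 by (intro \<theta>.integrable_const_bound[where B=1]) auto
    have "integral\<^sup>L Q (\<phi> j) - (\<integral>s. g s j \<partial>\<theta>) = (\<integral>s. g (rep (cell s)) j - g s j \<partial>\<theta>)"
      unfolding Qint using i1 i2 by simp
    also have "\<bar>\<dots>\<bar> \<le> (\<integral>s. \<bar>g (rep (cell s)) j - g s j\<bar> \<partial>\<theta>)"
      by (rule integral_abs_bound)
    also have "\<dots> \<le> (\<integral>s. 1 / n \<partial>\<theta>)"
      using i1 i2 near that by (intro integral_mono) auto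
    finally show ?thesis by (simp add: \<theta>.prob_space)
  qed
  then show ?thesis using Q Q01 unfolding g_def by blast
qed

text \<open>The approximating measures live on [0, 1], so they are tight and a subsequence converges
  weakly. The test functions are continuous and bounded, so their integrals pass to the
  limit.\<close>

lemma weak_mixture:
  fixes P :: "'s \<Rightarrow> real measure" and \<phi> :: "nat \<Rightarrow> real \<Rightarrow> real"
  assumes "prob_space \<theta>"
    and "\<And>s. s \<in> space \<theta> \<Longrightarrow> real_distribution (P s)"
    and "\<And>s. s \<in> space \<theta> \<Longrightarrow> emeasure (P s) {0..1} = 1"
    and \<phi>: "\<And>j. continuous_on UNIV (\<phi> j)" "\<And>j t. 0 \<le> \<phi> j t" "\<And>j t. \<phi> j t \<le> 1"
    and "\<And>j. (\<lambda>s. integral\<^sup>L (P s) (\<phi> j)) \<in> borel_measurable \<theta>"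
  shows "\<exists>Q. real_distribution Q \<and>
    (\<forall>j. integral\<^sup>L Q (\<phi> j) = (\<integral>s. integral\<^sup>L (P s) (\<phi> j) \<partial>\<theta>))"
proof -
  define L where "L j = (\<integral>s. integral\<^sup>L (P s) (\<phi> j) \<partial>\<theta>)" for j
  \<comment> \<open>Accuracy and number of controlled test functions both grow with
    \<open>n\<close>, so each fixed \<open>j\<close> is covered from \<open>n = j\<close>
    on.\<close>
  have "\<exists>Q. real_distribution Q \<and> emeasure Q {0..1} = 1 \<and>
    (\<forall>j<Suc n. \<bar>integral\<^sup>L Q (\<phi> j) - L j\<bar> \<le> 1 / real (Suc n))" for n
    unfolding L_def using assms
    by (intro weak_mixture_finite borel_measurable_continuous_onI) auto
  then obtain \<mu> where \<mu>: "\<And>n. real_distribution (\<mu> n)" "\<And>n. emeasure (\<mu> n) {0..1} = 1"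
    and near: "\<And>n j. j < Suc n \<Longrightarrow> \<bar>integral\<^sup>L (\<mu> n) (\<phi> j) - L j\<bar> \<le> 1 / real (Suc n)"
    by metis
  interpret \<mu>: real_distribution "\<mu> n" for n by (rule \<mu>)
  have lim: "(\<lambda>n. integral\<^sup>L (\<mu> n) (\<phi> j)) \<longlonglongrightarrow> L j" for j
  proof -
    have "(\<lambda>n. integral\<^sup>L (\<mu> n) (\<phi> j) - L j) \<longlonglongrightarrow> 0"
    proof (rule Lim_null_comparison[OF _ LIMSEQ_inverse_real_of_nat])
      show "\<forall>\<^sub>F n in sequentially. norm (integral\<^sup>L (\<mu> n) (\<phi> j) - L j) \<le> inverse (real (Suc n))"
        by (rule eventually_mono[OF eventually_ge_at_top[of j]])
           (use near[of j] in \<open>auto simp: inverse_eq_divide less_Suc_eq_le\<close>)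
    qed
    then show ?thesis by (simp add: LIM_zero_iff)
  qed
  have "tight \<mu>"
    unfolding tight_def
  proof (intro conjI allI impI \<mu>(1))
    fix \<epsilon> :: real assume "0 < \<epsilon>"
    \<comment> \<open>Tightness is phrased with intervals open on the left; starting at -1 keeps a
      possible atom at 0.\<close>
    have "measure (\<mu> n) {-1<..1} > 1 - \<epsilon>" for n
    proof -
      have "1 \<le> measure (\<mu> n) {-1<..1}"
        using \<mu>.finite_measure_mono[of "{0..1}" "{-1<..1}" n] \<mu>(2)[of n]
        by (simp add: measure_def subset_eq)
      then show ?thesis using \<open>0 < \<epsilon>\<close> by simp
    qed
    then show "\<exists>a b. a < b \<and> (\<forall>n. 1 - \<epsilon> < measure (\<mu> n) {a<..b})"
      by (intro exI[of _ "-1"] exI[of _ 1]) auto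
  qed
  then obtain r Q where r: "strict_mono r" and Q: "real_distribution Q"
    and w: "weak_conv_m (\<lambda>n. \<mu> (r n)) Q"
    using tight_imp_convergent_subsubsequence[of \<mu> id] by (auto simp: strict_mono_id comp_def)
  have "integral\<^sup>L Q (\<phi> j) = L j" for j
  proof -
    have "(\<lambda>n. integral\<^sup>L (\<mu> (r n)) (\<phi> j)) \<longlonglongrightarrow> integral\<^sup>L Q (\<phi> j)"
      using \<mu> Q w \<phi>
      by (intro weak_conv_imp_integral_bdd_continuous_conv[where B=1])
         (auto simp: continuous_on_eq_continuous_at)
    moreover have "(\<lambda>n. integral\<^sup>L (\<mu> (r n)) (\<phi> j)) \<longlonglongrightarrow> L j"
      using LIMSEQ_subseq_LIMSEQ[OF lim r] by (simp add: comp_def)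
    ultimately show ?thesis by (rule LIMSEQ_unique)
  qed
  then show ?thesis using Q unfolding L_def by blast
qed

subsection \<open>The kernel in the variables of the definition\<close>

text \<open>One sum type indexes both families of dual variables, so that the kernel becomes the
  exponential of a single sum.\<close>

definition dual_coord ::
  "'n + 'n \<times> 'n \<Rightarrow> ('n::{finite,linorder} \<Rightarrow> real) \<times> ('n \<times> 'n \<Rightarrow> real) \<Rightarrow> real" where
  "dual_coord e x = (case e of Inl i \<Rightarrow> fst x i | Inr p \<Rightarrow> snd x p)"

definition hyp_var :: "real ^ 'n::{finite,linorder} \<Rightarrow> 'n + 'n \<times> 'n \<Rightarrow> real" where
  "hyp_var v e = (case e of Inl i \<Rightarrow> v $ i + 1 / v $ i
     | Inr (i, j) \<Rightarrow> v $ i / v $ j + v $ j / v $ i)"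

definition hyp_index :: "('n::{finite,linorder} + 'n \<times> 'n) set" where
  "hyp_index = UNIV <+> index_pairs"

text \<open>
  The condition at \<open>v = 1\<close>, where the kernel is largest, makes the notion stable under mixtures whose
  components are finite only almost everywhere.
\<close>

definition hyp_laplace :: "(real ^ 'n::{finite,linorder} \<Rightarrow> ennreal) \<Rightarrow> bool" where
  "hyp_laplace g \<longleftrightarrow> g (\<chi> i. 1) < \<infinity> \<longrightarrow>
     (\<exists>\<nu>. sets \<nu> = sets dual_space \<and>
       (\<forall>v\<in>pos_orthant. g v = (\<integral>\<^sup>+x. hyp_kernel v x \<partial>\<nu>)))"

section \<open>Domination and continuity of the kernel\<close>

lemma one_in_pos_orthant [simp]: "(\<chi> i. 1) \<in> pos_orthant"
  by (simp add: pos_orthant_def)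

lemma hyp_kernel_eq:
  "hyp_kernel v x = exp (- (\<Sum>e\<in>hyp_index. dual_coord e x * hyp_var v e))"
proof -
  have "(\<Sum>e\<in>hyp_index. dual_coord e x * hyp_var v e) =
      (\<Sum>i\<in>UNIV. fst x i * (v $ i + 1 / v $ i)) +
      (\<Sum>p\<in>index_pairs. snd x p * (case p of (i, j) \<Rightarrow> v $ i / v $ j + v $ j / v $ i))"
    unfolding hyp_index_def by (subst sum.Plus) (simp_all add: dual_coord_def hyp_var_def)
  then show ?thesis
    by (simp add: hyp_kernel_def case_prod_unfold)
qed

lemma hyp_kernel_nonneg [simp]: "0 \<le> hyp_kernel v x"
  and hyp_kernel_pos [simp]: "0 < hyp_kernel v x"
  by (simp_all add: hyp_kernel_eq)

lemma hyp_var_one: "hyp_var (\<chi> i. 1) e = 2"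
  by (simp add: hyp_var_def split: sum.split prod.split)

lemma add_inverse_ge_2:
  fixes x :: real
  assumes "0 < x"
  shows "2 \<le> x + 1 / x" "x \<noteq> 1 \<Longrightarrow> 2 < x + 1 / x"
proof -
  have eq: "x + 1 / x - 2 = (x - 1)\<^sup>2 / x"
    using assms by (simp add: field_simps power2_eq_square)
  have "0 \<le> (x - 1)\<^sup>2 / x" using assms by simp
  then show "2 \<le> x + 1 / x" using eq by linarith
  assume "x \<noteq> 1"
  then have "0 < (x - 1)\<^sup>2 / x" using assms by simp
  then show "2 < x + 1 / x" using eq by linarith
qed

lemma hyp_var_ge_2: "v \<in> pos_orthant \<Longrightarrow> 2 \<le> hyp_var v e"
  using add_inverse_ge_2(1)[of "v $ i" for i] add_inverse_ge_2(1)[of "v $ i / v $ j" for i j]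
  by (auto simp: hyp_var_def pos_orthant_def split: sum.split)

lemma dual_coord_nonneg: "x \<in> space dual_space \<Longrightarrow> e \<in> hyp_index \<Longrightarrow> 0 \<le> dual_coord e x"
  by (auto simp: dual_space_def space_pair_measure space_PiM space_restrict_space PiE_iff
      dual_coord_def hyp_index_def)

lemma measurable_dual_coord [measurable]:
  assumes "e \<in> hyp_index"
  shows "dual_coord e \<in> borel_measurable dual_space"
proof -
  have [measurable]: "(\<lambda>y. y) \<in> restrict_space borel {0::real..} \<rightarrow>\<^sub>M borel"
    by (rule measurable_restrict_space1) simp
  show ?thesis
    using assms
  proof (cases e)
    case (Inl i)
    have "(\<lambda>x. fst x i) \<in> dual_space \<rightarrow>\<^sub>M restrict_space borel {0::real..}"
      unfolding dual_space_def by measurable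
    then have "(\<lambda>x. fst x i) \<in> dual_space \<rightarrow>\<^sub>M borel"
      by measurable
    then show ?thesis unfolding Inl dual_coord_def by simp
  next
    case (Inr p)
    then have p: "p \<in> index_pairs" using assms by (auto simp: hyp_index_def)
    have "(\<lambda>x. snd x p) \<in> dual_space \<rightarrow>\<^sub>M restrict_space borel {0::real..}"
      unfolding dual_space_def using p by measurable
    then have "(\<lambda>x. snd x p) \<in> dual_space \<rightarrow>\<^sub>M borel"
      by measurable
    then show ?thesis unfolding Inr dual_coord_def by simp
  qed
qed

lemma measurable_hyp_kernel [measurable]: "hyp_kernel v \<in> borel_measurable dual_space"
  unfolding hyp_kernel_eq[abs_def] by measurable

text \<open>Each \<open>hyp_var v e\<close> has the form x + 1/x and attains its minimum 2 at
  \<open>v = 1\<close>, while the dual variables are nonnegative.\<close>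

lemma hyp_kernel_le_one_point:
  assumes "x \<in> space dual_space" "v \<in> pos_orthant"
  shows "hyp_kernel v x \<le> hyp_kernel (\<chi> i. 1) x"
  unfolding hyp_kernel_eq hyp_var_one
  using assms by (auto intro!: sum_mono mult_left_mono hyp_var_ge_2 dual_coord_nonneg)

text \<open>On the dual space the quotient of the two kernels involves the dual variables only
  through the numbers \<open>exp (- dual_coord e x)\<close> in (0, 1], with exponents that are
  nonnegative for \<open>v\<close> in the orthant. This suggests a compact cube whose faces at 0
  stand for infinite dual variables.\<close>

lemma hyp_kernel_factor:
  "hyp_kernel v x = hyp_kernel (\<chi> i. 1) x *
     (\<Prod>e\<in>hyp_index. exp (- dual_coord e x) powr (hyp_var v e - 2))"
  unfolding hyp_kernel_eq hyp_var_one
  by (simp add: powr_def exp_sum[symmetric] exp_add[symmetric] sum_negf[symmetric]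
      sum.distrib[symmetric] algebra_simps flip: sum_subtractf)

lemma hyp_kernel_tendsto:
  assumes "v \<in> pos_orthant" "u \<longlonglongrightarrow> v"
  shows "(\<lambda>k. hyp_kernel (u k) x) \<longlonglongrightarrow> hyp_kernel v x"
proof -
  have "(\<lambda>k. hyp_var (u k) e) \<longlonglongrightarrow> hyp_var v e" for e
  proof -
    have nz: "v $ i \<noteq> 0" for i
      using assms(1) by (auto simp: pos_orthant_def less_le)
    show ?thesis
      unfolding hyp_var_def
      by (cases e) (auto simp: nz split: prod.split intro!: tendsto_intros assms(2))
  qed
  then show ?thesis
    unfolding hyp_kernel_eq by (intro tendsto_intros)
qed

lemma nn_integral_hyp_kernel_le:
  assumes [measurable_cong]: "sets \<nu> = sets dual_space" and "v \<in> pos_orthant"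
  shows "(\<integral>\<^sup>+x. hyp_kernel v x \<partial>\<nu>) \<le> (\<integral>\<^sup>+x. hyp_kernel (\<chi> i. 1) x \<partial>\<nu>)"
  using assms sets_eq_imp_space_eq[OF assms(1)]
  by (intro nn_integral_mono ennreal_leI hyp_kernel_le_one_point) auto

text \<open>Dominated convergence with the kernel at 1 as majorant. This continuity lets an identity
  between transforms be verified on a dense set only.\<close>

lemma nn_integral_hyp_kernel_tendsto:
  assumes [measurable_cong]: "sets \<nu> = sets dual_space"
    and fin: "(\<integral>\<^sup>+x. hyp_kernel (\<chi> i. 1) x \<partial>\<nu>) < \<infinity>"
    and "v \<in> pos_orthant" "\<And>k. u k \<in> pos_orthant" "u \<longlonglongrightarrow> v"
  shows "(\<lambda>k. \<integral>\<^sup>+x. hyp_kernel (u k) x \<partial>\<nu>) \<longlonglongrightarrow> (\<integral>\<^sup>+x. hyp_kernel v x \<partial>\<nu>)"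
  using assms sets_eq_imp_space_eq[OF assms(1)]
  by (intro nn_integral_dominated_convergence[OF _ _ _ _ fin])
     (auto intro!: AE_I2 hyp_kernel_le_one_point tendsto_ennrealI hyp_kernel_tendsto)

text \<open>
  Away from these \<open>v\<close> the quotient of \<open>hyp_kernel v\<close> and \<open>hyp_kernel 1\<close> need not extend continuously
  to infinite values of the dual variables.
\<close>

definition generic_orthant :: "(real ^ 'n::{finite,linorder}) set" where
  "generic_orthant = {v \<in> pos_orthant. \<forall>e\<in>hyp_index. 2 < hyp_var v e}"

lemma open_pos_orthant: "open (pos_orthant :: (real ^ 'n) set)"
  unfolding pos_orthant_def Collect_all_eq by (intro open_INT ballI open_Collect_less continuous_intros) simp

text \<open>The complement lies in the finitely many hyperplanes \<open>v $ i = 1\<close> and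
  \<open>v $ i = v $ j\<close>, whose union is negligible and cannot contain a nonempty open
  set.\<close>

lemma closure_generic_orthant: "pos_orthant \<subseteq> closure (generic_orthant :: (real ^ 'n::{finite,linorder}) set)"
proof
  fix v :: "real ^ 'n::{finite,linorder}"
  assume v: "v \<in> pos_orthant"
  define N where "N = (\<Union>i. {x :: real ^ 'n::{finite,linorder}. axis i 1 \<bullet> x = 1}) \<union>
    (\<Union>(i, j)\<in>index_pairs. {x :: real ^ 'n::{finite,linorder}. (axis i 1 - axis j 1) \<bullet> x = 0})"
  have "negligible N"
    unfolding N_def
    by (intro negligible_Un negligible_Union)
       (auto simp: index_pairs_def axis_eq_axis intro!: negligible_hyperplane)
  have *: "x \<in> generic_orthant" if "x \<in> pos_orthant" "x \<notin> N" for x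
  proof -
    have pos: "0 < x $ i" for i using that by (simp add: pos_orthant_def)
    have n1: "x $ i \<noteq> 1" for i using that by (auto simp: N_def inner_axis')
    have n2: "x $ i \<noteq> x $ j" if "i < j" for i j
      using \<open>x \<notin> N\<close> that by (auto simp: N_def inner_axis' inner_diff_left index_pairs_def)
    show ?thesis
      using that(1) add_inverse_ge_2(2)[OF pos n1]
        add_inverse_ge_2(2)[of "x $ i / x $ j" for i j] pos n2
      by (force simp: generic_orthant_def hyp_index_def hyp_var_def index_pairs_def
          divide_eq_1_iff)
  qed
  show "v \<in> closure generic_orthant"
    unfolding closure_approachable
  proof (intro allI impI)
    fix \<epsilon> :: real assume "0 < \<epsilon>"
    then have "v \<in> ball v \<epsilon> \<inter> pos_orthant" using v by simp
    then have "\<not> negligible (ball v \<epsilon> \<inter> pos_orthant)"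
      using open_pos_orthant by (intro open_not_negligible open_Int open_ball) blast+
    then obtain x where "x \<in> ball v \<epsilon>" "x \<in> pos_orthant" "x \<notin> N"
      using negligible_subset[OF \<open>negligible N\<close>] by blast
    then show "\<exists>y\<in>generic_orthant. dist y v < \<epsilon>"
      using * by (auto simp: dist_commute)
  qed
qed

text \<open>
  The coordinates of the curve stand for \<open>exp (- l i)\<close> and \<open>exp (- m (i, j))\<close>; the value \<open>0\<close>
  represents an infinite dual variable, where \<open>curve_dual\<close> takes the junk value \<open>ln 0 = 0\<close>. As
  \<open>0 powr a = 0\<close>, \<open>curve_kernel\<close> vanishes there, so mass escaping to infinity is harmless.
\<close>

definition curve :: "'n::{finite,linorder} + 'n \<times> 'n \<Rightarrow> real \<Rightarrow> real" where
  "curve e = schoenberg (to_nat e)"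

definition curve_section ::
  "('n::{finite,linorder} \<Rightarrow> real) \<times> ('n \<times> 'n \<Rightarrow> real) \<Rightarrow> real" where
  "curve_section x = schoenberg_section (\<lambda>m.
     if (from_nat m :: 'n + 'n \<times> 'n) \<in> hyp_index
     then exp (- dual_coord (from_nat m :: 'n + 'n \<times> 'n) x) else 1)"

definition curve_dual ::
  "real \<Rightarrow> ('n::{finite,linorder} \<Rightarrow> real) \<times> ('n \<times> 'n \<Rightarrow> real)" where
  "curve_dual t = (\<lambda>i. - ln (curve (Inl i) t), \<lambda>p\<in>index_pairs. - ln (curve (Inr p) t))"

definition curve_kernel :: "real ^ 'n::{finite,linorder} \<Rightarrow> real \<Rightarrow> real" where
  "curve_kernel v t = (\<Prod>e\<in>hyp_index. curve e t powr (hyp_var v e - 2))"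

section \<open>Transport between the dual space and the unit interval\<close>

lemma curve_range: "0 \<le> curve e t" "curve e t \<le> 1"
  by (simp_all add: curve_def schoenberg_range)

lemma continuous_on_curve [continuous_intros]: "continuous_on UNIV (curve e)"
  unfolding curve_def by (rule continuous_on_schoenberg)

lemma measurable_curve [measurable]: "curve e \<in> borel_measurable borel"
  by (rule borel_measurable_continuous_onI[OF continuous_on_curve])

lemma curve_section_range: "0 \<le> curve_section x" "curve_section x \<le> 1"
  by (simp_all add: curve_section_def schoenberg_section_range)

lemma measurable_curve_section [measurable]: "curve_section \<in> borel_measurable dual_space"
proof -
  have "(\<lambda>x. if e \<in> hyp_index then exp (- dual_coord e x) else 1) \<in> borel_measurable dual_space" for e
    by (cases "e \<in> hyp_index") auto
  then show ?thesis
    unfolding curve_section_def by measurable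
qed

lemma curve_curve_section:
  assumes "x \<in> space dual_space" "e \<in> hyp_index"
  shows "curve e (curve_section x) = exp (- dual_coord e x)"
  unfolding curve_def curve_section_def
  using assms dual_coord_nonneg[OF assms] by (subst schoenberg_section) auto

lemma ln_curve_le_0: "ln (curve e t) \<le> 0"
  using curve_range[of e t] by (cases "curve e t = 0") auto

lemma measurable_curve_dual [measurable]: "curve_dual \<in> borel \<rightarrow>\<^sub>M dual_space"
proof -
  have "(\<lambda>t. - ln (curve e t)) \<in> borel \<rightarrow>\<^sub>M restrict_space borel {0..}" for e :: "'a + 'a \<times> 'a"
  proof (rule measurable_restrict_space2)
    show "(\<lambda>t. - ln (curve e t)) \<in> space borel \<rightarrow> {0..}" by (auto simp: ln_curve_le_0)
  qed measurable
  then show ?thesis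
    unfolding curve_dual_def dual_space_def
    by (intro measurable_Pair measurable_PiM_single' measurable_restrict) (auto simp: space_restrict_space ln_curve_le_0)
qed

lemma dual_coord_curve_dual: "e \<in> hyp_index \<Longrightarrow> dual_coord e (curve_dual t) = - ln (curve e t)"
  by (auto simp: curve_dual_def dual_coord_def hyp_index_def)

text \<open>This carries integrals to the line: if a measure on the dual space is weighted by
  \<open>hyp_kernel 1\<close> and pushed forward along \<open>curve_section\<close>, the result
  integrates \<open>curve_kernel v\<close> as the original measure integrates
  \<open>hyp_kernel v\<close>.\<close>

lemma curve_kernel_section:
  assumes "x \<in> space dual_space"
  shows "hyp_kernel (\<chi> i. 1) x * curve_kernel v (curve_section x) = hyp_kernel v x"
  unfolding hyp_kernel_factor[of v] curve_kernel_def
  using assms by (simp add: curve_curve_section)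

text \<open>The way back from the curve parameter, available where no relevant coordinate vanishes,
  that is, where all dual variables are finite.\<close>

lemma curve_kernel_dual:
  fixes v :: "real ^ 'n::{finite,linorder}"
  assumes "\<And>e :: 'n + 'n \<times> 'n. e \<in> hyp_index \<Longrightarrow> 0 < curve e t"
  shows "hyp_kernel ((\<chi> i. 1) :: real ^ 'n::{finite,linorder}) (curve_dual t) * curve_kernel v t =
    hyp_kernel v (curve_dual t :: ('n \<Rightarrow> real) \<times> ('n \<times> 'n \<Rightarrow> real))"
  unfolding hyp_kernel_factor[of v] curve_kernel_def
  using assms by (simp add: dual_coord_curve_dual)

lemma curve_kernel_nonneg: "0 \<le> curve_kernel v t"
  by (simp add: curve_kernel_def prod_nonneg)

lemma curve_kernel_le_1:
  assumes "v \<in> pos_orthant"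
  shows "curve_kernel v t \<le> 1"
  unfolding curve_kernel_def
  using hyp_var_ge_2[OF assms] by (intro prod_le_1) (auto intro!: powr_le1 simp: curve_range)

lemma measurable_curve_kernel [measurable]: "curve_kernel v \<in> borel_measurable borel"
  unfolding curve_kernel_def by measurable

text \<open>For generic \<open>v\<close> all exponents are positive, so each factor tends to 0 at
  the zeros of its coordinate. Exponent 0 would produce a jump, because
  \<open>0 powr 0 = 0\<close>.\<close>

lemma continuous_on_curve_kernel:
  assumes "v \<in> generic_orthant"
  shows "continuous_on UNIV (curve_kernel v)"
  unfolding curve_kernel_def
  using assms curve_range
  by (intro continuous_on_prod continuous_on_powr' continuous_intros) (auto simp: generic_orthant_def)

lemma curve_kernel_eq_0:
  fixes v :: "real ^ 'n::{finite,linorder}" and e :: "'n + 'n \<times> 'n"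
  assumes "e \<in> hyp_index" "\<not> 0 < curve e t"
  shows "curve_kernel v t = 0"
proof -
  have "curve e t = 0" using assms(2) curve_range(1)[of e t] by simp
  then show ?thesis using assms(1) by (auto simp: curve_kernel_def)
qed



text \<open>After division by the values at \<open>v = 1\<close>, each \<open>G s\<close> is given
  by a probability measure on [0, 1] and the mixing measure becomes a probability measure as well.
  Then \<open>weak_mixture\<close> yields one measure \<open>Q\<close> with the right integrals at
  countably many generic \<open>v\<close>. It is carried back to the dual space, and continuity in
  \<open>v\<close> gives the remaining points.\<close>

lemma hyp_laplace_mixture:
  fixes G :: "'s \<Rightarrow> real ^ 'n::{finite,linorder} \<Rightarrow> ennreal"
  assumes meas: "\<And>v. v \<in> pos_orthant \<Longrightarrow> (\<lambda>s. G s v) \<in> borel_measurable \<mu>"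
    and G: "\<And>s. s \<in> space \<mu> \<Longrightarrow> hyp_laplace (G s)"
  shows "hyp_laplace (\<lambda>v. \<integral>\<^sup>+s. G s v \<partial>\<mu>)"
  unfolding hyp_laplace_def
proof
  let ?one = "(\<chi> i. 1) :: real ^ 'n::{finite,linorder}"
  define H where "H v = (\<integral>\<^sup>+s. G s v \<partial>\<mu>)" for v
  assume "(\<integral>\<^sup>+s. G s ?one \<partial>\<mu>) < \<infinity>"
  then have H1: "H ?one < \<infinity>" by (simp add: H_def)
  note [measurable] = meas
  have AE_fin: "AE s in \<mu>. G s ?one < \<infinity>"
    using nn_integral_PInf_AE[of "\<lambda>s. G s ?one" \<mu>] H1 meas[OF one_in_pos_orthant]
    by (auto simp: H_def less_top)
  have "\<exists>\<nu>. s \<in> space \<mu> \<and> G s ?one < \<infinity> \<longrightarrow> sets \<nu> = sets dual_space \<and>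
      (\<forall>v\<in>pos_orthant. G s v = (\<integral>\<^sup>+x. hyp_kernel v x \<partial>\<nu>))" for s
    using G[of s] unfolding hyp_laplace_def by blast
  then obtain \<nu> where \<nu>: "\<And>s. s \<in> space \<mu> \<Longrightarrow> G s ?one < \<infinity> \<Longrightarrow> sets (\<nu> s) = sets dual_space"
    and G_eq: "\<And>s v. s \<in> space \<mu> \<Longrightarrow> G s ?one < \<infinity> \<Longrightarrow> v \<in> pos_orthant \<Longrightarrow>
      G s v = (\<integral>\<^sup>+x. hyp_kernel v x \<partial>\<nu> s)"
    by metis
  have G_le: "G s v \<le> G s ?one" if "s \<in> space \<mu>" "G s ?one < \<infinity>" "v \<in> pos_orthant" for s v
    unfolding G_eq[OF that] G_eq[OF that(1,2) one_in_pos_orthant]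
    by (rule nn_integral_hyp_kernel_le[OF \<nu>[OF that(1,2)] that(3)])
  have H_le: "H v \<le> H ?one" if "v \<in> pos_orthant" for v
    unfolding H_def
  proof (rule nn_integral_mono_AE)
    show "AE s in \<mu>. G s v \<le> G s ?one"
      using AE_fin AE_space by eventually_elim (rule G_le[OF _ _ that])
  qed
  have H_tendsto: "(\<lambda>k. H (u k)) \<longlonglongrightarrow> H v"
    if v: "v \<in> pos_orthant" and u: "\<And>k. u k \<in> pos_orthant" "u \<longlonglongrightarrow> v" for u v
    unfolding H_def
  proof (rule nn_integral_dominated_convergence[where w="\<lambda>s. G s ?one"])
    show "(\<integral>\<^sup>+s. G s ?one \<partial>\<mu>) < \<infinity>" by fact
    show "AE s in \<mu>. G s (u j) \<le> G s ?one" for j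
      using AE_fin AE_space by eventually_elim (auto intro: G_le u)
    show "AE s in \<mu>. (\<lambda>i. G s (u i)) \<longlonglongrightarrow> G s v"
      using AE_fin AE_space
    proof eventually_elim
      case (elim s)
      have "(\<integral>\<^sup>+x. hyp_kernel ?one x \<partial>\<nu> s) < \<infinity>"
        using elim G_eq[OF elim(2,1) one_in_pos_orthant] by simp
      then show ?case
        unfolding G_eq[OF elim(2,1) v] G_eq[OF elim(2,1) u(1)]
        by (rule nn_integral_hyp_kernel_tendsto[OF \<nu>[OF elim(2,1)] _ v u])
    qed
  qed (use u v in measurable)
  have "\<exists>\<nu>. sets \<nu> = sets dual_space \<and> (\<forall>v\<in>pos_orthant. H v = (\<integral>\<^sup>+x. hyp_kernel v x \<partial>\<nu>))"
  proof (cases "H ?one = 0")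
    case True
    then have "H v = 0" if "v \<in> pos_orthant" for v
      using H_le[OF that] by simp
    then show ?thesis by (intro exI[of _ "null_measure dual_space"]) auto
  next
    case False
    \<comment> \<open>Where \<open>G s ?one\<close> is 0, all \<open>G s v\<close> with
      \<open>v\<close> in the orthant vanish by \<open>G_le\<close>, and it is infinite only on a
      null set. So restriction to \<open>S\<close> changes no integral.\<close>
    define S where "S = {s \<in> space \<mu>. 0 < G s ?one \<and> G s ?one < \<infinity>}"
    have SD: "s \<in> space \<mu>" "0 < G s ?one" "G s ?one < \<infinity>" if "s \<in> S" for s
      using that by (auto simp: S_def)
    have S [measurable]: "S \<in> sets \<mu>"
      unfolding S_def using meas[OF one_in_pos_orthant] by measurable
    \<comment> \<open>The weight makes \<theta> a probability measure and compensates for the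
      division of \<open>G s v\<close> by \<open>G s ?one\<close>.\<close>
    define \<theta> where "\<theta> = density (restrict_space \<mu> S) (\<lambda>s. G s ?one / H ?one)"
    have space_\<theta>: "space \<theta> = S"
      using S sets.sets_into_space[OF S] by (auto simp: \<theta>_def space_restrict_space)
    have meas_\<theta>: "f \<in> borel_measurable \<theta>" if "f \<in> borel_measurable \<mu>" for f :: "'s \<Rightarrow> ennreal"
      using that by (simp add: \<theta>_def measurable_restrict_space1)
    have \<theta>_int: "(\<integral>\<^sup>+s. G s v / G s ?one \<partial>\<theta>) = H v / H ?one" if v: "v \<in> pos_orthant" for v
    proof -
      have m: "(\<lambda>s. G s v) \<in> borel_measurable \<mu>" "(\<lambda>s. G s ?one) \<in> borel_measurable \<mu>"
        using v by measurable
      have "(\<integral>\<^sup>+s. G s v / G s ?one \<partial>\<theta>)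
          = (\<integral>\<^sup>+s. G s ?one / H ?one * (G s v / G s ?one) \<partial>restrict_space \<mu> S)"
        unfolding \<theta>_def using m
        by (subst nn_integral_density)
           (auto intro!: borel_measurable_divide_ennreal measurable_restrict_space1)
      also have "\<dots> = (\<integral>\<^sup>+s. G s v / H ?one \<partial>restrict_space \<mu> S)"
      proof (intro nn_integral_cong)
        fix s assume "s \<in> space (restrict_space \<mu> S)"
        then have "G s ?one / G s ?one = 1"
          by (intro ennreal_divide_self) (auto simp: space_restrict_space S_def less_top)
        then have "G s v / H ?one * (G s ?one / G s ?one) = G s v / H ?one" by simp
        then show "G s ?one / H ?one * (G s v / G s ?one) = G s v / H ?one"
          by (simp add: divide_ennreal_def ac_simps)
      qed
      also have "\<dots> = (\<integral>\<^sup>+s. G s v / H ?one * indicator S s \<partial>\<mu>)"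
        using S by (subst nn_integral_restrict_space) auto
      also have "\<dots> = (\<integral>\<^sup>+s. G s v / H ?one \<partial>\<mu>)"
      proof (intro nn_integral_cong_AE, use AE_fin AE_space in eventually_elim)
        case (elim s)
        then show ?case
          using G_le[of s v] v by (cases "s \<in> S") (auto simp: S_def)
      qed
      also have "\<dots> = H v / H ?one"
        unfolding H_def using m by (intro nn_integral_divide) auto
      finally show ?thesis .
    qed
    have "prob_space \<theta>"
    proof
      have "emeasure \<theta> (space \<theta>) = (\<integral>\<^sup>+s. 1 \<partial>\<theta>)" by simp
      also have "\<dots> = (\<integral>\<^sup>+s. G s ?one / G s ?one \<partial>\<theta>)"
        by (intro nn_integral_cong) (auto simp: space_\<theta> S_def less_top)
      finally show "emeasure \<theta> (space \<theta>) = 1"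
        using \<theta>_int[OF one_in_pos_orthant] False H1 by (simp add: less_top)
    qed
    then interpret \<theta>: prob_space \<theta> .
    define P where "P s = distr (density (\<nu> s) (\<lambda>x. hyp_kernel ?one x / G s ?one)) borel curve_section" for s
    have P_int: "(\<integral>\<^sup>+t. f t \<partial>P s) = (\<integral>\<^sup>+x. hyp_kernel ?one x * f (curve_section x) \<partial>\<nu> s) / G s ?one"
      if s: "s \<in> S" and [measurable]: "f \<in> borel_measurable borel" for s and f :: "real \<Rightarrow> ennreal"
    proof -
      have [measurable_cong]: "sets (\<nu> s) = sets dual_space" using s by (intro \<nu> SD)
      have "(\<integral>\<^sup>+t. f t \<partial>P s) =
          (\<integral>\<^sup>+x. ennreal (hyp_kernel ?one x) / G s ?one * f (curve_section x) \<partial>\<nu> s)"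
        unfolding P_def by (simp add: nn_integral_distr nn_integral_density)
      also have "\<dots> = (\<integral>\<^sup>+x. hyp_kernel ?one x * f (curve_section x) / G s ?one \<partial>\<nu> s)"
        by (simp add: divide_ennreal_def ac_simps)
      also have "\<dots> = (\<integral>\<^sup>+x. hyp_kernel ?one x * f (curve_section x) \<partial>\<nu> s) / G s ?one"
        by (rule nn_integral_divide) measurable
      finally show ?thesis .
    qed
    have P_curve: "(\<integral>\<^sup>+t. curve_kernel v t \<partial>P s) = G s v / G s ?one"
      if s: "s \<in> S" and v: "v \<in> pos_orthant" for s v
    proof -
      have "sets (\<nu> s) = sets dual_space" using s by (intro \<nu> SD)
      then have sp: "space (\<nu> s) = space dual_space" by (rule sets_eq_imp_space_eq)
      have "(\<integral>\<^sup>+x. ennreal (hyp_kernel ?one x) * ennreal (curve_kernel v (curve_section x)) \<partial>\<nu> s) =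
          (\<integral>\<^sup>+x. hyp_kernel v x \<partial>\<nu> s)"
        by (intro nn_integral_cong)
           (simp add: sp curve_kernel_section curve_kernel_nonneg flip: ennreal_mult')
      then show ?thesis
        using P_int[OF s, of "\<lambda>t. ennreal (curve_kernel v t)"]
        by (simp add: G_eq[OF SD(1,3)[OF s] v])
    qed
    have P_prob: "real_distribution (P s)" "emeasure (P s) {0..1} = 1" if s: "s \<in> S" for s
    proof -
      have 1: "(\<integral>\<^sup>+t. indicator B t \<partial>P s) = 1" if [measurable]: "B \<in> sets borel" and B: "{0..1} \<subseteq> B" for B
      proof -
        have "(\<integral>\<^sup>+x. ennreal (hyp_kernel ?one x) * indicator B (curve_section x) \<partial>\<nu> s) = (\<integral>\<^sup>+x. hyp_kernel ?one x \<partial>\<nu> s)"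
          using B by (intro nn_integral_cong) (simp add: subset_iff curve_section_range)
        then show ?thesis
          using P_int[OF s, of "indicator B"] SD[OF s]
          by (simp add: G_eq[OF SD(1,3)[OF s] one_in_pos_orthant, symmetric])
      qed
      show "emeasure (P s) {0..1} = 1" using 1[of "{0..1}"] by (simp add: P_def)
      show "real_distribution (P s)"
        using 1[of UNIV]
        by (auto simp: P_def real_distribution_def real_distribution_axioms_def intro!: prob_spaceI)
    qed
    obtain D :: "(real ^ 'n::{finite,linorder}) set" where D: "countable D" "D \<subseteq> generic_orthant" "generic_orthant \<subseteq> closure D"
      using separable[of "generic_orthant :: (real ^ 'n::{finite,linorder}) set"] by blast
    have closD: "pos_orthant \<subseteq> closure D"
      using closure_generic_orthant D(3) by (meson closure_minimal closed_closure subset_trans)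
    then have "D \<noteq> {}" using one_in_pos_orthant by (metis closure_empty empty_iff subset_empty)
    define w where "w = from_nat_into D"
    have wD: "w j \<in> D" for j using \<open>D \<noteq> {}\<close> by (simp add: w_def from_nat_into)
    have wg: "w j \<in> generic_orthant" and wp: "w j \<in> pos_orthant" for j
      using wD[of j] D(2) by (auto simp: generic_orthant_def)
    have P_lebesgue: "integral\<^sup>L (P s) (curve_kernel v) = enn2real (G s v / G s ?one)"
      if "s \<in> S" "v \<in> pos_orthant" for s v
      using P_curve[OF that]
      by (subst integral_eq_nn_integral) (auto simp: curve_kernel_nonneg P_def)
    \<comment> \<open>Although \<open>P s\<close> rests on an arbitrary choice of representing
      measures, these integrals are quotients of values of \<open>G\<close> and therefore measurable
      in \<open>s\<close>.\<close>
    have P_meas: "(\<lambda>s. integral\<^sup>L (P s) (curve_kernel v)) \<in> borel_measurable \<theta>"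
      if "v \<in> pos_orthant" for v :: "real ^ 'n::{finite,linorder}"
    proof (subst measurable_cong)
      show "integral\<^sup>L (P s) (curve_kernel v) = enn2real (G s v / G s ?one)" if "s \<in> space \<theta>" for s
        using P_lebesgue that \<open>v \<in> pos_orthant\<close> by (simp add: space_\<theta>)
      show "(\<lambda>s. enn2real (G s v / G s ?one)) \<in> borel_measurable \<theta>"
      proof -
        have [measurable]: "(\<lambda>s. G s v) \<in> borel_measurable \<theta>" "(\<lambda>s. G s ?one) \<in> borel_measurable \<theta>"
          using that by (auto intro!: meas_\<theta> meas)
        show ?thesis by measurable
      qed
    qed
    obtain Q where Q: "real_distribution Q"
      and Q_int: "\<And>j. integral\<^sup>L Q (curve_kernel (w j)) = (\<integral>s. integral\<^sup>L (P s) (curve_kernel (w j)) \<partial>\<theta>)"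
      using weak_mixture[OF \<open>prob_space \<theta>\<close>, of P "\<lambda>j. curve_kernel (w j)"] P_prob space_\<theta>
        continuous_on_curve_kernel[OF wg] curve_kernel_nonneg[of "w j" for j] curve_kernel_le_1[OF wp] P_meas[OF wp]
      by auto
    interpret Q: real_distribution Q by fact
    have Q_w: "(\<integral>\<^sup>+t. curve_kernel (w j) t \<partial>Q) = H (w j) / H ?one" for j
    proof -
      have le1: "G s (w j) / G s ?one \<le> 1" if "s \<in> S" for s
        using G_le[OF SD(1,3)[OF that] wp[of j]] SD[OF that]
        by (auto intro!: divide_le_posI_ennreal)
      have le1': "enn2real (G s (w j) / G s ?one) \<le> 1" if "s \<in> S" for s
        using enn2real_leI[of 1] le1[OF that] by simp
      have "(\<integral>\<^sup>+t. curve_kernel (w j) t \<partial>Q) = ennreal (integral\<^sup>L Q (curve_kernel (w j)))"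
        by (intro nn_integral_eq_integral Q.integrable_const_bound[where B=1])
           (auto simp: curve_kernel_nonneg curve_kernel_le_1[OF wp])
      also have "\<dots> = ennreal (\<integral>s. integral\<^sup>L (P s) (curve_kernel (w j)) \<partial>\<theta>)"
        unfolding Q_int ..
      also have "\<dots> = (\<integral>\<^sup>+s. ennreal (integral\<^sup>L (P s) (curve_kernel (w j))) \<partial>\<theta>)"
        using P_meas[OF wp] le1'
        by (intro nn_integral_eq_integral[symmetric] \<theta>.integrable_const_bound[where B=1] AE_I2)
           (auto simp: space_\<theta> P_lebesgue[OF _ wp])
      also have "\<dots> = (\<integral>\<^sup>+s. G s (w j) / G s ?one \<partial>\<theta>)"
        using le_less_trans[OF le1 ennreal_one_less_top]
        by (intro nn_integral_cong) (simp add: space_\<theta> P_lebesgue[OF _ wp])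
      also have "\<dots> = H (w j) / H ?one" by (rule \<theta>_int[OF wp])
      finally show ?thesis .
    qed
    \<comment> \<open>Off \<open>A\<close> some dual variable is infinite. That part of
      \<open>Q\<close> is discarded in \<open>N\<close>, at no cost since
      \<open>curve_kernel\<close> vanishes there; dividing by the kernel at 1 undoes the
      normalisation.\<close>
    define A where "A = {t. \<forall>e\<in>(hyp_index :: ('n + 'n \<times> 'n) set). 0 < curve e t}"
    have [measurable]: "A \<in> sets borel" unfolding A_def by measurable
    define N :: "(('n \<Rightarrow> real) \<times> ('n \<times> 'n \<Rightarrow> real)) measure"
      where "N = distr (density Q (\<lambda>t. H ?one * (ennreal (1 / hyp_kernel ?one (curve_dual t)) * indicator A t)))
      dual_space curve_dual"
    have N_int: "(\<integral>\<^sup>+x. hyp_kernel v x \<partial>N) = H ?one * (\<integral>\<^sup>+t. curve_kernel v t \<partial>Q)" for v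
    proof -
      have "(\<integral>\<^sup>+x. hyp_kernel v x \<partial>N) = (\<integral>\<^sup>+t. H ?one *
          (ennreal (1 / hyp_kernel ?one (curve_dual t)) * indicator A t * hyp_kernel v (curve_dual t)) \<partial>Q)"
        unfolding N_def by (simp add: nn_integral_distr nn_integral_density mult.assoc)
      also have "\<dots> = (\<integral>\<^sup>+t. H ?one * curve_kernel v t \<partial>Q)"
      proof (intro nn_integral_cong arg_cong2[where f="(*)"] refl)
        fix t
        show "ennreal (1 / hyp_kernel ?one (curve_dual t)) * indicator A t * hyp_kernel v (curve_dual t)
            = curve_kernel v t"
        proof (cases "t \<in> A")
          case True
          have "hyp_kernel ?one (curve_dual t) * curve_kernel v t = hyp_kernel v (curve_dual t)"
            by (rule curve_kernel_dual) (use True in \<open>simp add: A_def\<close>)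
          then have "1 / hyp_kernel ?one (curve_dual t) * hyp_kernel v (curve_dual t) = curve_kernel v t"
            using hyp_kernel_pos[of ?one "curve_dual t", THEN less_imp_neq] by (simp add: field_simps)
          then show ?thesis using True by (simp flip: ennreal_mult')
        next
          case False
          then show ?thesis by (auto simp: A_def curve_kernel_eq_0)
        qed
      qed
      finally show ?thesis by (simp add: nn_integral_cmult)
    qed
    \<comment> \<open>The function \<open>curve_kernel ?one\<close> is the indicator of
      \<open>A\<close>, so mass may still have been lost at \<open>v = 1\<close> and only finiteness
      is claimed. The exact value there comes from the limit argument below.\<close>
    have N_fin: "(\<integral>\<^sup>+x. hyp_kernel ?one x \<partial>N) < \<infinity>"
    proof -
      have "(\<integral>\<^sup>+t. curve_kernel ?one t \<partial>Q) \<le> (\<integral>\<^sup>+t. 1 \<partial>Q)"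
        by (intro nn_integral_mono) (simp add: curve_kernel_le_1)
      then have "(\<integral>\<^sup>+t. curve_kernel ?one t \<partial>Q) < \<infinity>"
        using Q.emeasure_space_1 le_less_trans[OF _ ennreal_one_less_top] by simp
      then show ?thesis using H1 by (simp add: N_int ennreal_mult_less_top)
    qed
    have N_w: "(\<integral>\<^sup>+x. hyp_kernel v x \<partial>N) = H v" if vD: "v \<in> D" for v
    proof -
      obtain j where "v = w j"
        using from_nat_into_surj[OF D(1) vD] by (auto simp: w_def)
      then show ?thesis
        unfolding N_int using Q_w[of j] False H1
        by (simp add: ennreal_times_divide mult_divide_eq_ennreal mult.commute less_top)
    qed
    \<comment> \<open>Both sides are continuous on the orthant and agree on \<open>D\<close>, whose
      closure contains it.\<close>
    have "(\<integral>\<^sup>+x. hyp_kernel v x \<partial>N) = H v" if v: "v \<in> pos_orthant" for v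
    proof -
      have "v \<in> closure D" using closD v by blast
      then obtain u where u: "\<And>k. u k \<in> D" "u \<longlonglongrightarrow> v"
        unfolding closure_sequential by blast
      have up: "u k \<in> pos_orthant" for k using u(1)[of k] D(2) by (auto simp: generic_orthant_def)
      have "(\<lambda>k. \<integral>\<^sup>+x. hyp_kernel (u k) x \<partial>N) \<longlonglongrightarrow> (\<integral>\<^sup>+x. hyp_kernel v x \<partial>N)"
        using N_fin v up u(2) by (intro nn_integral_hyp_kernel_tendsto) (auto simp: N_def)
      moreover have "(\<lambda>k. \<integral>\<^sup>+x. hyp_kernel (u k) x \<partial>N) \<longlonglongrightarrow> H v"
        using H_tendsto[OF v up u(2)] N_w[OF u(1)] by simp
      ultimately show ?thesis by (rule LIMSEQ_unique)
    qed
    then show ?thesis by (intro exI[of _ N]) (auto simp: N_def)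
  qed
  then show "\<exists>\<nu>. sets \<nu> = sets dual_space \<and>
      (\<forall>v\<in>pos_orthant. (\<integral>\<^sup>+s. G s v \<partial>\<mu>) = (\<integral>\<^sup>+x. hyp_kernel v x \<partial>\<nu>))"
    unfolding H_def .
qed

subsection \<open>Eliminating a vertex from a hyperbolic energy\<close>

lemma borel_measurable_cosh [measurable]: "(cosh :: real \<Rightarrow> real) \<in> borel_measurable borel"
  unfolding cosh_def[abs_def] by measurable

definition energy :: "'a set \<Rightarrow> ('a \<Rightarrow> 'a \<Rightarrow> real) \<Rightarrow> ('a \<Rightarrow> real) \<Rightarrow> real" where
  "energy V c p = (\<Sum>a\<in>V. \<Sum>b\<in>V. c a b * cosh (p a - p b))"

lemma energy_insert:
  assumes "finite V" "r \<notin> V"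
  shows "energy (insert r V) c p =
    c r r + energy V c p + (\<Sum>b\<in>V. (c r b + c b r) * cosh (p r - p b))"
proof -
  have "(\<Sum>b\<in>V. c b r * cosh (p b - p r)) = (\<Sum>b\<in>V. c b r * cosh (p r - p b))"
  proof (intro sum.cong refl)
    show "c b r * cosh (p b - p r) = c b r * cosh (p r - p b)" for b
      using cosh_minus[of "p r - p b"] by (simp del: cosh_minus)
  qed
  then show ?thesis
    using assms by (simp add: energy_def sum.distrib distrib_right)
qed

lemma energy_cong:
  assumes "\<And>a. a \<in> V \<Longrightarrow> p a = q a"
  shows "energy V c p = energy V c q"
  unfolding energy_def using assms by (intro sum.cong refl) simp

text \<open>Adding the double sum to its copy with \<open>a\<close> and \<open>b\<close> exchanged
  turns the exponentials into hyperbolic cosines.\<close>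

lemma sum_exp_mult_eq_energy:
  fixes k p :: "'a \<Rightarrow> real"
  shows "(\<Sum>a\<in>V. k a * exp (- p a)) * (\<Sum>a\<in>V. k a * exp (p a)) = energy V (\<lambda>a b. k a * k b) p"
proof -
  let ?P = "(\<Sum>a\<in>V. k a * exp (- p a)) * (\<Sum>a\<in>V. k a * exp (p a))"
  have 1: "?P = (\<Sum>a\<in>V. \<Sum>b\<in>V. k a * k b * exp (- (p a - p b)))"
    unfolding sum_product by (intro sum.cong refl) (simp add: exp_diff exp_minus field_simps)
  also have "\<dots> = (\<Sum>a\<in>V. \<Sum>b\<in>V. k b * k a * exp (- (p b - p a)))"
    by (rule sum.swap)
  finally have 2: "?P = (\<Sum>a\<in>V. \<Sum>b\<in>V. k a * k b * exp (p a - p b))"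
    by (simp add: mult.commute)
  have "2 * ?P = (\<Sum>a\<in>V. \<Sum>b\<in>V. k a * k b * (exp (p a - p b) + exp (- (p a - p b))))"
    using 1 2 by (simp add: sum.distrib distrib_left)
  also have "\<dots> = 2 * energy V (\<lambda>a b. k a * k b) p"
    by (simp add: energy_def cosh_def sum_distrib_left)
  finally show ?thesis by simp
qed

text \<open>Translation by \<open>ln B\<close>. Afterwards the coefficients enter only through
  \<open>A * B\<close>, and for a star this product is an energy of the neighbours by
  \<open>sum_exp_mult_eq_energy\<close>.\<close>

lemma nn_integral_exp_cosh_exchange:
  fixes A B :: real
  assumes "0 < B"
  shows "(\<integral>\<^sup>+h. exp (- (A * exp h + B * exp (- h))) \<partial>lborel) =
    (\<integral>\<^sup>+\<tau>. exp (- (A * B * exp \<tau> + exp (- \<tau>))) \<partial>lborel)"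
proof -
  have "(\<integral>\<^sup>+h. exp (- (A * exp h + B * exp (- h))) \<partial>lborel) =
    (\<integral>\<^sup>+\<tau>. exp (- (A * exp (ln B + \<tau>) + B * exp (- (ln B + \<tau>)))) \<partial>lborel)"
    by (subst nn_integral_real_affine[where c=1 and t="ln B"]) auto
  moreover have "A * exp (ln B + \<tau>) + B * exp (- (ln B + \<tau>)) = A * B * exp \<tau> + exp (- \<tau>)" for \<tau>
  proof -
    have "- (ln B + \<tau>) = - \<tau> - ln B" by simp
    then have "exp (- (ln B + \<tau>)) = exp (- \<tau>) / B"
      using assms exp_diff[of "- \<tau>" "ln B"] by (simp only: exp_ln)
    moreover have "exp (ln B + \<tau>) = B * exp \<tau>"
      using assms by (simp add: exp_add)
    ultimately show ?thesis using assms by simp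
  qed
  ultimately show ?thesis by (simp only:)
qed

text \<open>
  Integrating out the position of one vertex replaces its edges by edges between its neighbours
  (a star-mesh transformation), mixed over \<open>\<tau>\<close>.
\<close>

lemma nn_integral_energy_eliminate:
  fixes c :: "'a \<Rightarrow> 'a \<Rightarrow> real"
  assumes V: "finite V" "r \<notin> V"
    and c: "\<And>a b. 0 \<le> c a b" and "\<exists>b\<in>V. 0 < c r b"
  shows "(\<integral>\<^sup>+h. exp (- (\<delta> + energy (insert r V) c (p(r := h)))) \<partial>lborel) =
    (\<integral>\<^sup>+\<tau>. exp (- (\<delta> + c r r + exp (- \<tau>) +
       energy V (\<lambda>a b. c a b + exp \<tau> * ((c r a + c a r) / 2 * ((c r b + c b r) / 2))) p)) \<partial>lborel)"
proof -
  \<comment> \<open>Half the total weight between \<open>r\<close> and \<open>a\<close>: the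
    coefficient of each of the two exponentials in the hyperbolic cosine.\<close>
  define k where "k a = (c r a + c a r) / 2" for a
  define A where "A = (\<Sum>a\<in>V. k a * exp (- p a))"
  define B where "B = (\<Sum>a\<in>V. k a * exp (p a))"
  define \<kappa> where "\<kappa> = \<delta> + c r r + energy V c p"
  \<comment> \<open>The edge of positive weight leaving \<open>r\<close> makes \<open>ln B\<close> a
    legitimate shift.\<close>
  have "0 < B"
  proof -
    obtain b where b: "b \<in> V" "0 < c r b" using assms(4) by blast
    have "0 < k b" using b(2) c[of b r] by (simp add: k_def)
    then show ?thesis
      unfolding B_def using V b(1) c by (intro sum_pos2[of V b]) (auto simp: k_def)
  qed
  have star: "energy (insert r V) c (p(r := h)) + \<delta> = \<kappa> + (A * exp h + B * exp (- h))" for h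
  proof -
    have "energy V c (p(r := h)) = energy V c p"
      using V(2) by (intro energy_cong) auto
    moreover have "(\<Sum>b\<in>V. (c r b + c b r) * cosh (h - (p(r := h)) b)) = A * exp h + B * exp (- h)"
      unfolding A_def B_def sum_distrib_right sum.distrib[symmetric]
    proof (intro sum.cong refl)
      fix b assume "b \<in> V"
      then have pb: "(p(r := h)) b = p b" using V(2) by auto
      have ch: "cosh (h - p b) = (exp h * exp (- p b) + exp (- h) * exp (p b)) / 2"
        by (simp add: cosh_def flip: exp_add)
      show "(c r b + c b r) * cosh (h - (p(r := h)) b)
          = k b * exp (- p b) * exp h + k b * exp (p b) * exp (- h)"
        unfolding pb ch k_def by (simp add: algebra_simps add_divide_distrib)
    qed
    ultimately show ?thesis
      using energy_insert[OF V, of c "p(r := h)"] by (simp add: \<kappa>_def)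
  qed
  have mesh: "energy V (\<lambda>a b. c a b + exp \<tau> * (k a * k b)) p = energy V c p + A * B * exp \<tau>" for \<tau>
    unfolding A_def B_def sum_exp_mult_eq_energy
    unfolding energy_def sum_distrib_right sum.distrib[symmetric]
    by (intro sum.cong refl) (simp add: algebra_simps)
  have "(\<integral>\<^sup>+h. exp (- (\<delta> + energy (insert r V) c (p(r := h)))) \<partial>lborel)
      = (\<integral>\<^sup>+h. ennreal (exp (- \<kappa>)) * ennreal (exp (- (A * exp h + B * exp (- h)))) \<partial>lborel)"
    using star by (simp add: add.commute exp_add[symmetric] flip: ennreal_mult')
  also have "\<dots> = ennreal (exp (- \<kappa>)) * (\<integral>\<^sup>+h. exp (- (A * exp h + B * exp (- h))) \<partial>lborel)"
    by (rule nn_integral_cmult) measurable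
  also have "\<dots> = ennreal (exp (- \<kappa>)) * (\<integral>\<^sup>+\<tau>. exp (- (A * B * exp \<tau> + exp (- \<tau>))) \<partial>lborel)"
    by (simp only: nn_integral_exp_cosh_exchange[OF \<open>0 < B\<close>])
  also have "\<dots> = (\<integral>\<^sup>+\<tau>. ennreal (exp (- \<kappa>)) * exp (- (A * B * exp \<tau> + exp (- \<tau>))) \<partial>lborel)"
    by (rule nn_integral_cmult[symmetric]) measurable
  also have "\<dots> = (\<integral>\<^sup>+\<tau>. exp (- (\<delta> + c r r + exp (- \<tau>) +
      energy V (\<lambda>a b. c a b + exp \<tau> * (k a * k b)) p)) \<partial>lborel)"
    unfolding mesh \<kappa>_def
    by (intro nn_integral_cong) (simp add: algebra_simps flip: ennreal_mult' exp_add)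
  finally show ?thesis unfolding k_def .
qed

text \<open>
  The vertices \<open>Inl i\<close> carry the variables to be integrated out. The fixed vertices \<open>Inr (Some i)\<close> and
  \<open>Inr None\<close> sit at \<open>- ln (v i)\<close> and \<open>0\<close>: their mutual distances produce exactly the variables
  \<open>v i / v j + v j / v i\<close> and \<open>v i + 1 / v i\<close>.
\<close>

definition vertex_pos :: "real ^ 'n::{finite,linorder} \<Rightarrow> 'n + 'n option \<Rightarrow> real" where
  "vertex_pos v a = (case a of Inr (Some i) \<Rightarrow> - ln (v $ i) | _ \<Rightarrow> 0)"

lemma sum_pairs_split:
  fixes g :: "'n::{finite,linorder} \<Rightarrow> 'n \<Rightarrow> real"
  shows "(\<Sum>i\<in>UNIV. \<Sum>j\<in>UNIV. g i j) = (\<Sum>i\<in>UNIV. g i i) + (\<Sum>(i, j)\<in>index_pairs. g i j + g j i)"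
proof -
  have U: "(UNIV :: ('n \<times> 'n) set) = (range (\<lambda>i. (i, i)) \<union> index_pairs) \<union> prod.swap ` index_pairs"
    by (force simp: index_pairs_def image_iff)
  have "(\<Sum>i\<in>UNIV. \<Sum>j\<in>UNIV. g i j) = (\<Sum>(i, j)\<in>UNIV. g i j)"
    by (simp add: sum.cartesian_product)
  also have "\<dots> = (\<Sum>(i, j)\<in>range (\<lambda>i. (i, i)). g i j) + (\<Sum>(i, j)\<in>index_pairs. g i j)
      + (\<Sum>(i, j)\<in>prod.swap ` index_pairs. g i j)"
    unfolding U by (subst sum.union_disjoint; (subst sum.union_disjoint)?) (auto simp: index_pairs_def)
  also have "(\<Sum>(i, j)\<in>range (\<lambda>i. (i, i)). g i j) = (\<Sum>i\<in>UNIV. g i i)"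
    by (subst sum.reindex) (auto simp: inj_on_def)
  also have "(\<Sum>(i, j)\<in>prod.swap ` index_pairs. g i j) = (\<Sum>(i, j)\<in>index_pairs. g j i)"
    by (subst sum.reindex) (auto simp: case_prod_unfold)
  finally show ?thesis by (simp add: sum.distrib case_prod_unfold)
qed

lemma energy_fixed_vertices:
  fixes v :: "real ^ 'n::{finite,linorder}"
  assumes "v \<in> pos_orthant"
  shows "energy (range Inr) c (vertex_pos v) =
    c (Inr None) (Inr None) + (\<Sum>i\<in>UNIV. c (Inr (Some i)) (Inr (Some i))) +
    (\<Sum>i\<in>UNIV. (c (Inr None) (Inr (Some i)) + c (Inr (Some i)) (Inr None)) / 2 * (v $ i + 1 / v $ i)) +
    (\<Sum>(i, j)\<in>index_pairs. (c (Inr (Some i)) (Inr (Some j)) + c (Inr (Some j)) (Inr (Some i))) / 2 *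
       (v $ i / v $ j + v $ j / v $ i))"
proof -
  have pos: "0 < v $ i" for i using assms by (simp add: pos_orthant_def)
  have [simp]: "v $ i \<noteq> 0" for i using pos[of i] by simp
  have U: "range Inr = insert (Inr None) (Inr ` range Some :: ('n + 'n option) set)"
    by (metis UNIV_option_conv image_insert)
  have c1: "cosh (ln (v $ i)) = (v $ i + 1 / v $ i) / 2" for i
    using pos[of i] by (simp add: cosh_ln_real inverse_eq_divide)
  have c2: "cosh (ln (v $ j) - ln (v $ i)) = (v $ i / v $ j + v $ j / v $ i) / 2" for i j
  proof -
    have "ln (v $ j) - ln (v $ i) = ln (v $ j / v $ i)"
      using pos[of i] pos[of j] by (simp add: ln_div)
    then show ?thesis using pos[of i] pos[of j] by (simp add: cosh_ln_real)
  qed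
  have "energy (range Inr) c (vertex_pos v) = c (Inr None) (Inr None) +
      (\<Sum>i\<in>UNIV. \<Sum>j\<in>UNIV. c (Inr (Some i)) (Inr (Some j)) * cosh (ln (v $ j) - ln (v $ i))) +
      (\<Sum>i\<in>UNIV. (c (Inr None) (Inr (Some i)) + c (Inr (Some i)) (Inr None)) * cosh (ln (v $ i)))"
    unfolding U
    by (subst energy_insert) (auto simp: energy_def sum.reindex inj_on_def vertex_pos_def)
  then show ?thesis
    unfolding sum_pairs_split c1 c2 by (simp add: case_prod_unfold algebra_simps add_divide_distrib)
qed

text \<open>The representing measure is a point mass at the half-sums of the two weights of each
  edge. The self-loops, where cosh is 1, and \<delta> only contribute its total mass.\<close>

lemma hyp_laplace_fixed_energy:
  assumes c: "\<And>a b. 0 \<le> c a b"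
  shows "hyp_laplace (\<lambda>v :: real ^ 'n::{finite,linorder}.
    ennreal (exp (- (\<delta> + energy (range Inr) c (vertex_pos v)))))"
  unfolding hyp_laplace_def
proof
  define l where "l i = (c (Inr None) (Inr (Some i)) + c (Inr (Some i)) (Inr None)) / 2" for i :: 'n
  define m where "m = (\<lambda>(i :: 'n, j)\<in>index_pairs.
    (c (Inr (Some i)) (Inr (Some j)) + c (Inr (Some j)) (Inr (Some i))) / 2)"
  define \<kappa> where "\<kappa> = \<delta> + c (Inr None) (Inr None) + (\<Sum>i\<in>(UNIV :: 'n set). c (Inr (Some i)) (Inr (Some i)))"
  define \<nu> where "\<nu> = scale_measure (ennreal (exp (- \<kappa>))) (return dual_space (l, m))"
  have lm: "(l, m) \<in> space dual_space"
    using c by (auto simp: dual_space_def space_pair_measure space_PiM space_restrict_space l_def m_def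
        PiE_iff extensional_def)
  have "ennreal (exp (- (\<delta> + energy (range Inr) c (vertex_pos v)))) = (\<integral>\<^sup>+x. hyp_kernel v x \<partial>\<nu>)"
    if v: "v \<in> pos_orthant" for v :: "real ^ 'n::{finite,linorder}"
  proof -
    have "(\<integral>\<^sup>+x. hyp_kernel v x \<partial>\<nu>) = ennreal (exp (- \<kappa>)) * hyp_kernel v (l, m)"
      unfolding \<nu>_def by (simp add: nn_integral_scale_measure nn_integral_return[OF lm])
    also have "\<dots> = ennreal (exp (- \<kappa>) * hyp_kernel v (l, m))"
      by (simp flip: ennreal_mult')
    also have "exp (- \<kappa>) * hyp_kernel v (l, m) = exp (- (\<delta> + energy (range Inr) c (vertex_pos v)))"
      unfolding energy_fixed_vertices[OF v] hyp_kernel_def \<kappa>_def l_def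
      by (simp add: m_def case_prod_unfold flip: exp_add)
    finally show ?thesis ..
  qed
  then show "\<exists>\<nu>. sets \<nu> = sets dual_space \<and>
      (\<forall>v\<in>pos_orthant. ennreal (exp (- (\<delta> + energy (range Inr) c (vertex_pos v)))) =
        (\<integral>\<^sup>+x. hyp_kernel v x \<partial>\<nu>))"
    by (intro exI[of _ \<nu>]) (auto simp: \<nu>_def)
qed

text \<open>Free vertices are eliminated one by one. Each elimination changes weights and constant,
  so the induction is over all \<open>c\<close> and \<delta>. Weights never decrease, so every
  remaining free vertex keeps a positive edge to a fixed one, as the next elimination
  requires.\<close>

lemma hyp_laplace_energy:
  fixes T :: "('n::{finite,linorder} + 'n option) set"
  assumes "finite T" "T \<subseteq> range Inl" "\<And>a b. 0 \<le> c a b" "\<And>r. r \<in> T \<Longrightarrow> \<exists>b\<in>range Inr. 0 < c r b"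
  shows "hyp_laplace (\<lambda>v :: real ^ 'n::{finite,linorder}. \<integral>\<^sup>+h. ennreal (exp (- (\<delta> + energy (T \<union> range Inr) c
    (\<lambda>a. if a \<in> T then h a else vertex_pos v a)))) \<partial>(\<Pi>\<^sub>M a\<in>T. lborel))"
  using assms
proof (induction T arbitrary: c \<delta> rule: finite_induct)
  case empty
  then show ?case
    using hyp_laplace_fixed_energy[of c \<delta>] by (simp add: PiM_empty nn_integral_count_space_finite)
next
  case (insert r T)
  interpret product_sigma_finite "\<lambda>_ :: 'n + 'n option. lborel :: real measure" ..
  interpret PT: pair_sigma_finite "\<Pi>\<^sub>M a\<in>T. (lborel :: real measure)" "lborel :: real measure"
    unfolding pair_sigma_finite_def using sigma_finite[OF insert(1)] sigma_finite_lborel by simp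
  define V :: "('n + 'n option) set" where "V = T \<union> range Inr"
  have V: "finite V" "r \<notin> V" "insert r T \<union> range Inr = insert r V"
    using insert by (auto simp: V_def)
  define c' where "c' \<tau> a b = c a b + exp \<tau> * ((c r a + c a r) / 2 * ((c r b + c b r) / 2))" for \<tau> a b
  define \<delta>' where "\<delta>' \<tau> = \<delta> + c r r + exp (- \<tau>)" for \<tau>
  define q where "q v h a = (if a \<in> T then h a else vertex_pos v a)" for v :: "real ^ 'n::{finite,linorder}" and h a
  have qm [measurable]: "(\<lambda>x. q v (f x) a) \<in> borel_measurable M"
    if "f \<in> M \<rightarrow>\<^sub>M (\<Pi>\<^sub>M a\<in>T. lborel)" for v a f and M :: "'z measure"
  proof (cases "a \<in> T")
    case True
    then show ?thesis
      unfolding q_def using measurable_compose[OF that measurable_component_singleton[of a T]] by simp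
  qed (simp add: q_def)
  have [measurable]: "(\<lambda>x. if a \<in> insert r T then x a else vertex_pos v a) \<in> borel_measurable (\<Pi>\<^sub>M a\<in>insert r T. lborel)"
    for v :: "real ^ 'n::{finite,linorder}" and a
    by (cases "a \<in> insert r T") auto
  have eq: "(\<integral>\<^sup>+h. ennreal (exp (- (\<delta> + energy (insert r T \<union> range Inr) c
      (\<lambda>a. if a \<in> insert r T then h a else vertex_pos v a)))) \<partial>(\<Pi>\<^sub>M a\<in>insert r T. lborel)) =
    (\<integral>\<^sup>+\<tau>. \<integral>\<^sup>+h. ennreal (exp (- (\<delta>' \<tau> + energy V (c' \<tau>) (q v h)))) \<partial>(\<Pi>\<^sub>M a\<in>T. lborel) \<partial>lborel)"
    (is "?L = ?R") for v :: "real ^ 'n::{finite,linorder}"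
  proof -
    have "?L = (\<integral>\<^sup>+h. \<integral>\<^sup>+y. ennreal (exp (- (\<delta> + energy (insert r T \<union> range Inr) c
      (\<lambda>a. if a \<in> insert r T then (h(r := y)) a else vertex_pos v a)))) \<partial>lborel \<partial>(\<Pi>\<^sub>M a\<in>T. lborel))"
      unfolding energy_def using insert(1,2) by (intro product_nn_integral_insert) measurable
    also have "\<dots> = (\<integral>\<^sup>+h. \<integral>\<^sup>+y. ennreal (exp (- (\<delta> + energy (insert r V) c ((q v h)(r := y)))))
        \<partial>lborel \<partial>(\<Pi>\<^sub>M a\<in>T. lborel))"
      unfolding V(3) by (intro nn_integral_cong arg_cong[where f=ennreal] arg_cong[where f=exp]
        arg_cong[where f=uminus] arg_cong2[where f="(+)"] refl energy_cong) (auto simp: q_def)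
    also have "\<dots> = (\<integral>\<^sup>+h. \<integral>\<^sup>+\<tau>. ennreal (exp (- (\<delta>' \<tau> + energy V (c' \<tau>) (q v h)))) \<partial>lborel \<partial>(\<Pi>\<^sub>M a\<in>T. lborel))"
      unfolding \<delta>'_def c'_def using insert.prems(3)[of r]
      by (intro nn_integral_cong nn_integral_energy_eliminate V insert.prems) (auto simp: V_def)
    \<comment> \<open>With \<tau> outside, the inner integral is an instance of the induction
      hypothesis and \<tau> becomes a mixing parameter.\<close>
    also have "\<dots> = ?R"
      unfolding energy_def \<delta>'_def c'_def by (intro PT.Fubini'[symmetric]) measurable
    finally show ?thesis .
  qed
  show ?case
    unfolding eq
  proof (rule hyp_laplace_mixture)
    fix v :: "real ^ 'n::{finite,linorder}"
    show "(\<lambda>\<tau>. \<integral>\<^sup>+h. ennreal (exp (- (\<delta>' \<tau> + energy V (c' \<tau>) (q v h)))) \<partial>(\<Pi>\<^sub>M a\<in>T. lborel))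
        \<in> borel_measurable lborel"
      unfolding energy_def \<delta>'_def c'_def by measurable
  next
    fix \<tau> :: real
    show "hyp_laplace (\<lambda>v. \<integral>\<^sup>+h. ennreal (exp (- (\<delta>' \<tau> + energy V (c' \<tau>) (q v h)))) \<partial>(\<Pi>\<^sub>M a\<in>T. lborel))"
      unfolding V_def q_def
    proof (rule insert.IH)
      show "0 \<le> c' \<tau> a b" for a b
        unfolding c'_def using insert.prems(2) by simp
      then show "\<exists>b\<in>range Inr. 0 < c' \<tau> s b" if s: "s \<in> T" for s
      proof -
        obtain b where "b \<in> range Inr" "0 < c s b" using insert.prems(3)[OF insertI2[OF s]] by (rule bexE)
        moreover have "c s b \<le> c' \<tau> s b"
          unfolding c'_def using insert.prems(2) by simp
        ultimately show ?thesis by (meson less_le_trans)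
      qed
    qed (use insert.prems in auto)
  qed
qed

subsection \<open>Logarithmic coordinates\<close>

text \<open>The half-line is exhausted by compact intervals, on which the substitution rule applies,
  and monotone convergence gives the limit. \<open>Suc n\<close> keeps every interval
  nondegenerate.\<close>

lemma nn_integral_exp_substitution:
  fixes f :: "real \<Rightarrow> ennreal"
  assumes [measurable]: "f \<in> borel_measurable borel"
  shows "(\<integral>\<^sup>+x. f x * indicator {0<..} x \<partial>lborel) = (\<integral>\<^sup>+a. f (exp a) * ennreal (exp a) \<partial>lborel)"
proof -
  have step: "(\<integral>\<^sup>+x. f x * indicator {exp (- real (Suc n))..exp (real (Suc n))} x \<partial>lborel) =
      (\<integral>\<^sup>+a. f (exp a) * ennreal (exp a) * indicator {- real (Suc n)..real (Suc n)} a \<partial>lborel)" for n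
    by (rule nn_integral_substitution_aux) (auto intro!: derivative_eq_intros continuous_intros)
  have "(\<integral>\<^sup>+x. f x * indicator {0<..} x \<partial>lborel) =
      (\<integral>\<^sup>+x. (SUP n. f x * indicator {exp (- real (Suc n))..exp (real (Suc n))} x) \<partial>lborel)"
  proof (intro nn_integral_cong)
    fix x :: real
    show "f x * indicator {0<..} x = (SUP n. f x * indicator {exp (- real (Suc n))..exp (real (Suc n))} x)"
    proof (cases "0 < x")
      case True
      obtain n :: nat where n: "\<bar>ln x\<bar> \<le> real n" using real_arch_simple by blast
      have "exp (- real (Suc n)) \<le> exp (ln x)" "exp (ln x) \<le> exp (real (Suc n))"
        using n by (simp_all only: exp_le_cancel_iff)
      then have "x \<in> {exp (- real (Suc n))..exp (real (Suc n))}" using True by simp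
      then have "f x \<le> (SUP n. f x * indicator {exp (- real (Suc n))..exp (real (Suc n))} x)"
        by (intro SUP_upper2[of n]) auto
      moreover have "(SUP n. f x * indicator {exp (- real (Suc n))..exp (real (Suc n))} x) \<le> f x"
        by (intro SUP_least) (auto simp: indicator_def)
      ultimately show ?thesis using True by (auto intro: antisym)
    next
      case False
      then have "x \<notin> {exp (- real (Suc n))..exp (real (Suc n))}" for n
        using exp_gt_zero[of "- real (Suc n)"] by (auto simp del: exp_gt_zero)
      then show ?thesis using False by simp
    qed
  qed
  also have "\<dots> = (SUP n. \<integral>\<^sup>+x. f x * indicator {exp (- real (Suc n))..exp (real (Suc n))} x \<partial>lborel)"
  proof (intro nn_integral_monotone_convergence_SUP)
    have sub: "{exp (- real (Suc m))..exp (real (Suc m))} \<subseteq> {exp (- real (Suc n))..exp (real (Suc n))}"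
      if "m \<le> n" for m n
      using that by (subst atLeastatMost_subset_iff) (simp del: of_nat_Suc)
    show "incseq (\<lambda>n x. f x * indicator {exp (- real (Suc n))..exp (real (Suc n))} x)"
      unfolding incseq_def le_fun_def
      by (intro allI impI mult_left_mono) (auto simp: indicator_def simp del: atLeastAtMost_iff of_nat_Suc dest: sub[THEN subsetD])
  qed measurable
  also have "\<dots> = (SUP n. \<integral>\<^sup>+a. f (exp a) * ennreal (exp a) * indicator {- real (Suc n)..real (Suc n)} a \<partial>lborel)"
    unfolding step ..
  also have "\<dots> = (\<integral>\<^sup>+a. (SUP n. f (exp a) * ennreal (exp a) * indicator {- real (Suc n)..real (Suc n)} a) \<partial>lborel)"
    by (intro nn_integral_monotone_convergence_SUP[symmetric])
       (auto simp: incseq_def le_fun_def indicator_def intro!: mult_left_mono)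
  also have "\<dots> = (\<integral>\<^sup>+a. f (exp a) * ennreal (exp a) \<partial>lborel)"
  proof (intro nn_integral_cong antisym)
    fix a :: real
    obtain n :: nat where n: "\<bar>a\<bar> \<le> real n" using real_arch_simple by blast
    show "f (exp a) * ennreal (exp a) \<le> (SUP n. f (exp a) * ennreal (exp a) * indicator {- real (Suc n)..real (Suc n)} a)"
      using n by (intro SUP_upper2[of n]) (auto simp: indicator_def)
  qed (auto intro!: SUP_least simp: indicator_def)
  finally show ?thesis .
qed

text \<open>One coordinate at a time: integrating out the new coordinate produces an integrand
  \<open>F\<close> in the others, so the induction is over all \<open>f\<close>.\<close>

lemma nn_integral_exp_substitution_PiM:
  fixes f :: "('a \<Rightarrow> real) \<Rightarrow> ennreal"
  assumes "finite I" "f \<in> borel_measurable (\<Pi>\<^sub>M i\<in>I. lborel)"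
  shows "(\<integral>\<^sup>+x. f x * (\<Prod>i\<in>I. indicator {0<..} (x i)) \<partial>(\<Pi>\<^sub>M i\<in>I. lborel)) =
    (\<integral>\<^sup>+a. f (\<lambda>i\<in>I. exp (a i)) * (\<Prod>i\<in>I. ennreal (exp (a i))) \<partial>(\<Pi>\<^sub>M i\<in>I. lborel))"
  using assms
proof (induction I arbitrary: f rule: finite_induct)
  case empty
  then show ?case by (simp add: PiM_empty nn_integral_count_space_finite restrict_def)
next
  case (insert r I)
  interpret product_sigma_finite "\<lambda>_ :: 'a. lborel :: real measure" ..
  interpret PI: pair_sigma_finite "\<Pi>\<^sub>M a\<in>I. (lborel :: real measure)" "lborel :: real measure"
    unfolding pair_sigma_finite_def using sigma_finite[OF insert(1)] sigma_finite_lborel by simp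
  note [measurable] = insert.prems
  have upd: "(\<Prod>i\<in>I. g ((x(r := y)) i)) = (\<Prod>i\<in>I. g (x i))" for g :: "real \<Rightarrow> ennreal" and x y
    using insert(2) by (intro prod.cong refl) auto
  have [measurable]: "(\<lambda>a. \<lambda>i\<in>insert r I. exp (a i)) \<in>
      (\<Pi>\<^sub>M i\<in>insert r I. lborel :: real measure) \<rightarrow>\<^sub>M (\<Pi>\<^sub>M i\<in>insert r I. lborel)"
    by (intro measurable_restrict measurable_compose[OF measurable_component_singleton])
       auto
  have [measurable]: "(\<lambda>a. \<lambda>i\<in>I. exp (a i)) \<in>
      (\<Pi>\<^sub>M i\<in>I. lborel :: real measure) \<rightarrow>\<^sub>M (\<Pi>\<^sub>M i\<in>I. lborel)"
    by (intro measurable_restrict measurable_compose[OF measurable_component_singleton])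
       auto
  define F where "F x = (\<integral>\<^sup>+y. f (x(r := exp y)) * ennreal (exp y) \<partial>lborel)" for x
  have [measurable]: "F \<in> borel_measurable (\<Pi>\<^sub>M i\<in>I. lborel)"
    unfolding F_def by measurable
  have "(\<integral>\<^sup>+x. f x * (\<Prod>i\<in>insert r I. indicator {0<..} (x i)) \<partial>(\<Pi>\<^sub>M i\<in>insert r I. lborel))
      = (\<integral>\<^sup>+x. \<integral>\<^sup>+y. f (x(r := y)) * (\<Prod>i\<in>insert r I. indicator {0<..} ((x(r := y)) i)) \<partial>lborel \<partial>(\<Pi>\<^sub>M i\<in>I. lborel))"
    using insert(1,2) by (intro product_nn_integral_insert) measurable
  also have "\<dots> = (\<integral>\<^sup>+x. F x * (\<Prod>i\<in>I. indicator {0<..} (x i)) \<partial>(\<Pi>\<^sub>M i\<in>I. lborel))"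
  proof (intro nn_integral_cong)
    fix x :: "'a \<Rightarrow> real" assume x [measurable]: "x \<in> space (\<Pi>\<^sub>M i\<in>I. lborel)"
    have [measurable]: "(\<lambda>y. f (x(r := y))) \<in> borel_measurable borel"
      using measurable_compose[OF measurable_component_update[OF x insert(2)] insert.prems]
      by (simp add: fun_upd_def)
    have "(\<integral>\<^sup>+y. f (x(r := y)) * (\<Prod>i\<in>insert r I. indicator {0<..} ((x(r := y)) i)) \<partial>lborel)
        = (\<integral>\<^sup>+y. f (x(r := y)) * indicator {0<..} y * (\<Prod>i\<in>I. indicator {0<..} (x i)) \<partial>lborel)"
      using insert(1,2) by (simp add: upd mult.assoc fun_upd_same del: fun_upd_apply)
    also have "\<dots> = (\<integral>\<^sup>+y. f (x(r := y)) * indicator {0<..} y \<partial>lborel) * (\<Prod>i\<in>I. indicator {0<..} (x i))"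
      by (rule nn_integral_multc) measurable
    finally show "(\<integral>\<^sup>+y. f (x(r := y)) * (\<Prod>i\<in>insert r I. indicator {0<..} ((x(r := y)) i)) \<partial>lborel)
        = F x * (\<Prod>i\<in>I. indicator {0<..} (x i))"
      unfolding F_def by (subst (asm) nn_integral_exp_substitution) simp_all
  qed
  also have "\<dots> = (\<integral>\<^sup>+a. F (\<lambda>i\<in>I. exp (a i)) * (\<Prod>i\<in>I. ennreal (exp (a i))) \<partial>(\<Pi>\<^sub>M i\<in>I. lborel))"
    by (rule insert.IH) measurable
  also have "\<dots> = (\<integral>\<^sup>+a. \<integral>\<^sup>+y. f (\<lambda>i\<in>insert r I. exp ((a(r := y)) i)) *
      (\<Prod>i\<in>insert r I. ennreal (exp ((a(r := y)) i))) \<partial>lborel \<partial>(\<Pi>\<^sub>M i\<in>I. lborel))"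
  proof (intro nn_integral_cong)
    fix a :: "'a \<Rightarrow> real" assume "a \<in> space (\<Pi>\<^sub>M i\<in>I. lborel)"
    define x where "x = (\<lambda>i\<in>I. exp (a i))"
    have x: "x \<in> space (\<Pi>\<^sub>M i\<in>I. lborel)" by (simp add: x_def space_PiM)
    have [measurable]: "(\<lambda>y. f (x(r := y))) \<in> borel_measurable borel"
      using measurable_compose[OF measurable_component_update[OF x insert(2)] insert.prems]
      by (simp add: fun_upd_def)
    have "x(r := exp y) = (\<lambda>i\<in>insert r I. exp ((a(r := y)) i))" for y
      using insert(2) by (auto simp: x_def fun_eq_iff)
    moreover have "(\<Prod>i\<in>insert r I. ennreal (exp ((a(r := y)) i))) = ennreal (exp y) * (\<Prod>i\<in>I. ennreal (exp (a i)))" for y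
      using insert(1,2) upd[of "\<lambda>z. ennreal (exp z)" a y]
      by (simp add: fun_upd_same del: fun_upd_apply)
    moreover have "F x * (\<Prod>i\<in>I. ennreal (exp (a i))) =
        (\<integral>\<^sup>+y. f (x(r := exp y)) * ennreal (exp y) * (\<Prod>i\<in>I. ennreal (exp (a i))) \<partial>lborel)"
      unfolding F_def by (rule nn_integral_multc[symmetric]) measurable
    ultimately show "F (\<lambda>i\<in>I. exp (a i)) * (\<Prod>i\<in>I. ennreal (exp (a i))) =
        (\<integral>\<^sup>+y. f (\<lambda>i\<in>insert r I. exp ((a(r := y)) i)) *
          (\<Prod>i\<in>insert r I. ennreal (exp ((a(r := y)) i))) \<partial>lborel)"
      by (simp add: mult.assoc flip: x_def)
  qed
  also have "\<dots> = (\<integral>\<^sup>+a. f (\<lambda>i\<in>insert r I. exp (a i)) * (\<Prod>i\<in>insert r I. ennreal (exp (a i))) \<partial>(\<Pi>\<^sub>M i\<in>insert r I. lborel))"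
    using insert(1,2) by (intro product_nn_integral_insert[symmetric]) measurable
  finally show ?case .
qed

text \<open>The injection \<open>k\<close> lets the product be indexed by the vertices
  \<open>Inl i\<close> as well as by the coordinates themselves. Lebesgue measure is recognised by
  its values on boxes.\<close>

lemma lborel_vec_eq_distr_PiM:
  fixes k :: "'n::finite \<Rightarrow> 'a"
  assumes "inj k"
  shows "(lborel :: (real ^ 'n) measure) = distr (\<Pi>\<^sub>M a\<in>range k. lborel) borel (\<lambda>g. \<chi> i. g (k i))"
proof (rule lborel_eqI)
  interpret product_sigma_finite "\<lambda>_ :: 'a. lborel :: real measure" ..
  have m: "(\<lambda>g. \<chi> i. g (k i)) \<in> (\<Pi>\<^sub>M a\<in>range k. (lborel :: real measure)) \<rightarrow>\<^sub>M borel"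
    by (subst borel_measurable_euclidean_space) (auto simp: Basis_vec_def inner_axis)
  fix l u :: "real ^ 'n" assume le: "\<And>b. b \<in> Basis \<Longrightarrow> l \<bullet> b \<le> u \<bullet> b"
  then have le': "l $ i \<le> u $ i" for i
    by (metis axis_in_Basis_iff cart_eq_inner_axis Basis_real_def insertI1)
  have "(\<lambda>g. \<chi> i. g (k i)) -` box l u \<inter> space (\<Pi>\<^sub>M a\<in>range k. (lborel :: real measure))
      = (\<Pi>\<^sub>E a\<in>range k. {l $ inv k a<..<u $ inv k a})"
    using assms by (auto simp: mem_box_cart space_PiM PiE_iff)
  then have "emeasure (distr (\<Pi>\<^sub>M a\<in>range k. lborel) borel (\<lambda>g. \<chi> i. g (k i))) (box l u)
      = emeasure (\<Pi>\<^sub>M a\<in>range k. lborel) (\<Pi>\<^sub>E a\<in>range k. {l $ inv k a<..<u $ inv k a})"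
    by (subst emeasure_distr[OF m]) auto
  also have "\<dots> = (\<Prod>a\<in>range k. emeasure lborel {l $ inv k a<..<u $ inv k a})"
    by (intro emeasure_PiM) auto
  also have "\<dots> = (\<Prod>i\<in>UNIV. ennreal (u $ i - l $ i))"
    using assms le' by (subst prod.reindex) auto
  also have "\<dots> = (\<Prod>b\<in>Basis. (u - l) \<bullet> b)"
    using le' by (subst prod_ennreal) (auto simp: Basis_vec_def axis_eq_axis inj_on_def
       prod.UNION_disjoint inner_axis)
  finally show "emeasure (distr (\<Pi>\<^sub>M a\<in>range k. lborel) borel (\<lambda>g. \<chi> i. g (k i))) (box l u)
      = (\<Prod>b\<in>Basis. (u - l) \<bullet> b)" .
qed simp

lemma nn_integral_lborel_vec:
  fixes k :: "'n::finite \<Rightarrow> 'a" and f :: "real ^ 'n \<Rightarrow> ennreal"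
  assumes k: "inj k" and [measurable]: "f \<in> borel_measurable borel"
  shows "(\<integral>\<^sup>+x. f x \<partial>lborel) = (\<integral>\<^sup>+g. f (\<chi> i. g (k i)) \<partial>(\<Pi>\<^sub>M a\<in>range k. lborel))"
proof -
  have [measurable]: "(\<lambda>g. \<chi> i. g (k i)) \<in> (\<Pi>\<^sub>M a\<in>range k. (lborel :: real measure)) \<rightarrow>\<^sub>M borel"
    by (subst borel_measurable_euclidean_space) (auto simp: Basis_vec_def inner_axis)
  show ?thesis
    by (subst lborel_vec_eq_distr_PiM[OF k]) (simp add: nn_integral_distr)
qed

lemma nn_integral_pos_orthant_exp:
  fixes f :: "real ^ 'n::finite \<Rightarrow> ennreal"
  assumes [measurable]: "f \<in> borel_measurable borel"
  shows "(\<integral>\<^sup>+x. f x * indicator pos_orthant x \<partial>lborel) =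
    (\<integral>\<^sup>+a. f (\<chi> i. exp (a $ i)) * ennreal (\<Prod>i\<in>UNIV. exp (a $ i)) \<partial>lborel)"
proof -
  have [measurable]: "pos_orthant \<in> sets (borel :: (real ^ 'n) measure)"
    by (intro borel_open open_pos_orthant)
  have mv: "(\<lambda>g. \<chi> i. g i) \<in> (\<Pi>\<^sub>M a\<in>UNIV. (lborel :: real measure)) \<rightarrow>\<^sub>M (borel :: (real ^ 'n) measure)"
    by (subst borel_measurable_euclidean_space) (auto simp: Basis_vec_def inner_axis)
  have [measurable]: "(\<lambda>a :: real ^ 'n. \<chi> i. exp (a $ i)) \<in> borel_measurable borel"
    by (intro borel_measurable_continuous_onI continuous_on_vec_lambda continuous_intros)
  have ind: "indicator pos_orthant (\<chi> i. g i) = (\<Prod>i\<in>UNIV. indicator {0<..} (g i) :: ennreal)" for g :: "'n \<Rightarrow> real"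
    by (auto simp: pos_orthant_def indicator_def)
  have "(\<integral>\<^sup>+x. f x * indicator pos_orthant x \<partial>lborel)
     = (\<integral>\<^sup>+g. f (\<chi> i. g i) * (\<Prod>i\<in>UNIV. indicator {0<..} (g i)) \<partial>(\<Pi>\<^sub>M i\<in>UNIV. lborel))"
    by (subst nn_integral_lborel_vec[of "\<lambda>i. i"]) (simp_all add: ind inj_on_def)
  also have "\<dots> = (\<integral>\<^sup>+g. f (\<chi> i. exp (g i)) * (\<Prod>i\<in>UNIV. ennreal (exp (g i))) \<partial>(\<Pi>\<^sub>M i\<in>UNIV. lborel))"
    using measurable_compose[OF mv, of f] by (subst nn_integral_exp_substitution_PiM) (auto simp: restrict_UNIV)
  also have "\<dots> = (\<integral>\<^sup>+a. f (\<chi> i. exp (a $ i)) * ennreal (\<Prod>i\<in>UNIV. exp (a $ i)) \<partial>lborel)"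
    by (subst nn_integral_lborel_vec[of "\<lambda>i. i"]) (simp_all add: prod_ennreal inj_on_def)
  finally show ?thesis .
qed

text \<open>First \<open>b = a - 2 *\<^sub>R h\<close>, with Jacobian \<open>2 ^ DIM('a)\<close>;
  then, with \<open>h\<close> outside, the translation \<open>a = c + h\<close>, which turns
  \<open>b\<close> into \<open>c - h\<close>.\<close>

lemma nn_integral_sum_difference:
  fixes \<Phi> :: "'a::euclidean_space \<Rightarrow> 'a \<Rightarrow> ennreal"
  assumes [measurable]: "case_prod \<Phi> \<in> borel_measurable (borel \<Otimes>\<^sub>M borel)"
  shows "(\<integral>\<^sup>+a. \<integral>\<^sup>+b. \<Phi> a b \<partial>lborel \<partial>lborel) =
    (\<integral>\<^sup>+c. \<integral>\<^sup>+h. ennreal (2 ^ DIM('a)) * \<Phi> (c + h) (c - h) \<partial>lborel \<partial>lborel)"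
proof -
  have [measurable]: "(\<lambda>x. \<Phi> (g x) (h x)) \<in> borel_measurable M"
    if "g \<in> M \<rightarrow>\<^sub>M borel" "h \<in> M \<rightarrow>\<^sub>M borel" for g h and M :: "'z measure"
    using measurable_compose[OF measurable_Pair[OF that] assms] by simp
  have inner: "(\<integral>\<^sup>+b. \<Phi> a b \<partial>lborel) = (\<integral>\<^sup>+h. ennreal (2 ^ DIM('a)) * \<Phi> a (a - 2 *\<^sub>R h) \<partial>lborel)" for a
    by (subst lborel_affine[of "- 2" a]) (simp_all add: nn_integral_density nn_integral_distr)
  have shift: "(\<integral>\<^sup>+a. f a \<partial>lborel) = (\<integral>\<^sup>+c. f (h + c) \<partial>lborel)"
    if [measurable]: "f \<in> borel_measurable borel" for f :: "'a \<Rightarrow> ennreal" and h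
    by (subst lborel_distr_plus[of h, symmetric]) (simp add: nn_integral_distr)
  have "(\<integral>\<^sup>+a. \<integral>\<^sup>+b. \<Phi> a b \<partial>lborel \<partial>lborel) =
      (\<integral>\<^sup>+a. \<integral>\<^sup>+h. ennreal (2 ^ DIM('a)) * \<Phi> a (a - 2 *\<^sub>R h) \<partial>lborel \<partial>lborel)"
    by (simp add: inner)
  also have "\<dots> = (\<integral>\<^sup>+h. \<integral>\<^sup>+a. ennreal (2 ^ DIM('a)) * \<Phi> a (a - 2 *\<^sub>R h) \<partial>lborel \<partial>lborel)"
    by (rule lborel_pair.Fubini'[symmetric]) measurable
  also have "\<dots> = (\<integral>\<^sup>+h. \<integral>\<^sup>+c. ennreal (2 ^ DIM('a)) * \<Phi> (h + c) (h + c - 2 *\<^sub>R h) \<partial>lborel \<partial>lborel)"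
    by (intro nn_integral_cong shift) measurable
  also have "\<dots> = (\<integral>\<^sup>+h. \<integral>\<^sup>+c. ennreal (2 ^ DIM('a)) * \<Phi> (c + h) (c - h) \<partial>lborel \<partial>lborel)"
    by (simp add: scaleR_2 algebra_simps)
  also have "\<dots> = (\<integral>\<^sup>+c. \<integral>\<^sup>+h. ennreal (2 ^ DIM('a)) * \<Phi> (c + h) (c - h) \<partial>lborel \<partial>lborel)"
    by (rule lborel_pair.Fubini') measurable
  finally show ?thesis .
qed

text \<open>The factors 2 come from t + 1/t = 2 cosh (ln t). As \<open>energy\<close> runs over
  ordered pairs, each edge carries its weight in one direction only, starting at a free
  vertex.\<close>

definition coupling ::
  "('n::{finite,linorder} \<Rightarrow> real) \<Rightarrow> ('n \<Rightarrow> real) \<times> ('n \<times> 'n \<Rightarrow> real) \<Rightarrow>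
    'n + 'n option \<Rightarrow> 'n + 'n option \<Rightarrow> real" where
  "coupling w x a b = (case a of Inr _ \<Rightarrow> 0 | Inl i \<Rightarrow>
     (case b of Inl j \<Rightarrow> if i < j then 2 * snd x (i, j) else 0
      | Inr None \<Rightarrow> 2 * fst x i
      | Inr (Some j) \<Rightarrow> if i = j then w i else 0))"

lemma coupling_nonneg:
  assumes "\<And>i. 0 < w i" "x \<in> space dual_space"
  shows "0 \<le> coupling w x a b"
proof -
  have 1: "0 \<le> fst x i" for i
    using dual_coord_nonneg[OF assms(2), of "Inl i"] by (auto simp: hyp_index_def dual_coord_def)
  have 2: "0 \<le> snd x (i, j)" if "i < j" for i j
    using dual_coord_nonneg[OF assms(2), of "Inr (i, j)"] that
    by (auto simp: hyp_index_def dual_coord_def index_pairs_def)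
  show ?thesis
    using 1 2 assms(1) by (auto simp: coupling_def less_imp_le split: sum.split option.split)
qed

lemma sum_sum_option:
  fixes g :: "'n::finite + 'n option \<Rightarrow> real"
  shows "(\<Sum>a\<in>UNIV. g a) = (\<Sum>i\<in>UNIV. g (Inl i)) + g (Inr None) + (\<Sum>i\<in>UNIV. g (Inr (Some i)))"
proof -
  have "(\<Sum>a\<in>UNIV. g a) = (\<Sum>i\<in>UNIV. g (Inl i)) + (\<Sum>q\<in>UNIV. g (Inr q))"
    unfolding UNIV_Plus_UNIV[symmetric] by (subst sum.Plus) (simp_all add: comp_def)
  also have "(\<Sum>q\<in>UNIV. g (Inr q)) = g (Inr None) + (\<Sum>i\<in>UNIV. g (Inr (Some i)))"
    unfolding UNIV_option_conv by (simp add: sum.reindex)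
  finally show ?thesis by simp
qed

lemma energy_coupling:
  fixes h v :: "real ^ 'n::{finite,linorder}"
  assumes "\<And>i. p (Inl i) = h $ i" "p (Inr None) = 0" "\<And>i. p (Inr (Some i)) = - ln (v $ i)"
  shows "exp (- (\<delta> + energy UNIV (coupling w x) p)) =
    exp (- (\<delta> + (\<Sum>i\<in>UNIV. w i * cosh (h $ i + ln (v $ i))))) * hyp_kernel (\<chi> i. exp (h $ i)) x"
proof -
  have "energy UNIV (coupling w x) p = (\<Sum>i\<in>UNIV. \<Sum>b\<in>UNIV. coupling w x (Inl i) b * cosh (h $ i - p b))"
    unfolding energy_def sum_sum_option[of "\<lambda>a. \<Sum>b\<in>UNIV. coupling w x a b * cosh (p a - p b)"]
    by (simp add: coupling_def assms)
  also have "\<dots> = (\<Sum>i\<in>UNIV. (\<Sum>j\<in>UNIV. if i < j then 2 * snd x (i, j) * cosh (h $ i - h $ j) else 0) +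
      2 * fst x i * cosh (h $ i) + w i * cosh (h $ i + ln (v $ i)))"
  proof (intro sum.cong refl)
    fix i
    have "(\<Sum>j\<in>UNIV. (if i = j then w i else 0) * cosh (h $ i + ln (v $ j))) = w i * cosh (h $ i + ln (v $ i))"
      by (subst sum.mono_neutral_right[of _ "{i}"]) auto
    moreover have "(\<Sum>j\<in>UNIV. (if i < j then 2 * snd x (i, j) else 0) * cosh (h $ i - h $ j)) =
       (\<Sum>j\<in>UNIV. if i < j then 2 * snd x (i, j) * cosh (h $ i - h $ j) else 0)"
      by (intro sum.cong) auto
    ultimately show "(\<Sum>b\<in>UNIV. coupling w x (Inl i) b * cosh (h $ i - p b)) =
      (\<Sum>j\<in>UNIV. if i < j then 2 * snd x (i, j) * cosh (h $ i - h $ j) else 0) +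
      2 * fst x i * cosh (h $ i) + w i * cosh (h $ i + ln (v $ i))"
      unfolding sum_sum_option[of "\<lambda>b. coupling w x (Inl i) b * cosh (h $ i - p b)"]
      by (simp add: coupling_def assms)
  qed
  also have "\<dots> = (\<Sum>(i, j)\<in>index_pairs. 2 * snd x (i, j) * cosh (h $ i - h $ j)) +
      (\<Sum>i\<in>UNIV. 2 * fst x i * cosh (h $ i)) + (\<Sum>i\<in>UNIV. w i * cosh (h $ i + ln (v $ i)))"
  proof -
    have "(\<Sum>i\<in>UNIV. \<Sum>j\<in>UNIV. if i < j then 2 * snd x (i, j) * cosh (h $ i - h $ j) else 0) =
      (\<Sum>(i, j)\<in>UNIV. if i < j then 2 * snd x (i, j) * cosh (h $ i - h $ j) else 0)"
      by (simp add: sum.cartesian_product)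
    also have "\<dots> = (\<Sum>(i, j)\<in>index_pairs. if i < j then 2 * snd x (i, j) * cosh (h $ i - h $ j) else 0)"
      by (intro sum.mono_neutral_right) (auto simp: index_pairs_def split: if_splits)
    also have "\<dots> = (\<Sum>(i, j)\<in>index_pairs. 2 * snd x (i, j) * cosh (h $ i - h $ j))"
      by (intro sum.cong) (auto simp: index_pairs_def)
    finally show ?thesis by (simp add: sum.distrib)
  qed
  finally have E: "energy UNIV (coupling w x) p = \<dots>" .
  have c1: "2 * cosh t = exp t + 1 / exp t" for t :: real
    by (simp add: cosh_def exp_minus inverse_eq_divide)
  have c2: "2 * cosh (s - t) = exp s / exp t + exp t / exp s" for s t :: real
    by (simp add: c1 exp_diff)
  have "hyp_kernel (\<chi> i. exp (h $ i)) x = exp (- (\<Sum>i\<in>UNIV. 2 * fst x i * cosh (h $ i))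
      - (\<Sum>(i, j)\<in>index_pairs. 2 * snd x (i, j) * cosh (h $ i - h $ j)))"
    by (simp add: hyp_kernel_def case_prod_unfold c1[symmetric] c2[symmetric] ac_simps)
  then show ?thesis
    unfolding E by (simp add: algebra_simps flip: exp_add)
qed

lemma hyp_laplace_cong:
  assumes "hyp_laplace g" "\<And>v. v \<in> pos_orthant \<Longrightarrow> g v = g' v"
  shows "hyp_laplace g'"
  using assms unfolding hyp_laplace_def by (metis one_in_pos_orthant)

text \<open>The dual variables in \<open>x\<close> may all be 0; it is the positive
  \<open>w i\<close> that ties each free vertex \<open>Inl i\<close> to the fixed vertex
  \<open>Inr (Some i)\<close>, as the elimination requires.\<close>

lemma hyp_laplace_cosh_hyp_kernel:
  fixes w :: "'n::{finite,linorder} \<Rightarrow> real"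
  assumes w: "\<And>i. 0 < w i" and x: "x \<in> space dual_space"
  shows "hyp_laplace (\<lambda>v :: real ^ 'n::{finite,linorder}. \<integral>\<^sup>+h. ennreal
    (exp (- (\<delta> + (\<Sum>i\<in>UNIV. w i * cosh (h $ i + ln (v $ i))))) * hyp_kernel (\<chi> i. exp (h $ i)) x) \<partial>lborel)"
proof (rule hyp_laplace_cong)
  have U: "range Inl \<union> range Inr = (UNIV :: ('n + 'n option) set)"
    by (metis UNIV_Plus_UNIV Plus_def)
  let ?p = "\<lambda>(v :: real ^ 'n::{finite,linorder}) g (a :: 'n + 'n option).
    if a \<in> range Inl then g a else vertex_pos v a"
  show "hyp_laplace (\<lambda>v :: real ^ 'n::{finite,linorder}. \<integral>\<^sup>+g. ennreal (exp (- (\<delta> +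
      energy (range Inl \<union> range Inr) (coupling w x) (?p v g)))) \<partial>(\<Pi>\<^sub>M a\<in>range Inl. lborel))"
  proof (rule hyp_laplace_energy)
    show "\<exists>b\<in>range Inr. 0 < coupling w x r b" if r: "r \<in> range Inl" for r
    proof -
      obtain i where "r = Inl i" using r by blast
      then have "0 < coupling w x r (Inr (Some i))" using w by (simp add: coupling_def)
      then show ?thesis by blast
    qed
  qed (use coupling_nonneg[OF w x] in auto)
  fix v :: "real ^ 'n::{finite,linorder}"
  have "(\<integral>\<^sup>+g. ennreal (exp (- (\<delta> +
      energy (range Inl \<union> range Inr) (coupling w x) (?p v g)))) \<partial>(\<Pi>\<^sub>M a\<in>range Inl. lborel)) =
    (\<integral>\<^sup>+g. ennreal (exp (- (\<delta> + (\<Sum>i\<in>UNIV. w i * cosh ((\<chi> i. g (Inl i)) $ i + ln (v $ i))))) *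
       hyp_kernel (\<chi> i. exp ((\<chi> i. g (Inl i)) $ i)) x)
       \<partial>(\<Pi>\<^sub>M a\<in>(range Inl :: ('n + 'n option) set). lborel))"
  proof (rule nn_integral_cong)
    fix g :: "'n + 'n option \<Rightarrow> real"
    have "exp (- (\<delta> + energy UNIV (coupling w x) (?p v g))) =
        exp (- (\<delta> + (\<Sum>i\<in>UNIV. w i * cosh ((\<chi> i. g (Inl i)) $ i + ln (v $ i))))) *
        hyp_kernel (\<chi> i. exp ((\<chi> i. g (Inl i)) $ i)) x"
      by (rule energy_coupling) (auto simp: vertex_pos_def)
    then show "ennreal (exp (- (\<delta> + energy (range Inl \<union> range Inr) (coupling w x) (?p v g)))) =
        ennreal (exp (- (\<delta> + (\<Sum>i\<in>UNIV. w i * cosh ((\<chi> i. g (Inl i)) $ i + ln (v $ i))))) *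
        hyp_kernel (\<chi> i. exp ((\<chi> i. g (Inl i)) $ i)) x)"
      unfolding U by simp
  qed
  also have "\<dots> = (\<integral>\<^sup>+h. ennreal (exp (- (\<delta> + (\<Sum>i\<in>UNIV. w i * cosh (h $ i + ln (v $ i))))) *
       hyp_kernel (\<chi> i. exp (h $ i)) x) \<partial>lborel)"
  proof (rule nn_integral_lborel_vec[symmetric])
    show "(\<lambda>h. ennreal (exp (- (\<delta> + (\<Sum>i\<in>UNIV. w i * cosh (h $ i + ln (v $ i))))) *
       hyp_kernel (\<chi> i. exp (h $ i)) x)) \<in> borel_measurable borel"
      unfolding hyp_kernel_def by (simp add: case_prod_unfold) measurable
  qed simp
  finally show "(\<integral>\<^sup>+g. ennreal (exp (- (\<delta> +
      energy (range Inl \<union> range Inr) (coupling w x) (?p v g)))) \<partial>(\<Pi>\<^sub>M a\<in>range Inl. lborel)) =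
    (\<integral>\<^sup>+h. ennreal (exp (- (\<delta> + (\<Sum>i\<in>UNIV. w i * cosh (h $ i + ln (v $ i))))) *
       hyp_kernel (\<chi> i. exp (h $ i)) x) \<partial>lborel)" .
qed

text \<open>The kernel is positive everywhere, so the sets where it is at least
  \<open>1 / Suc n\<close> exhaust the space, and by Markov's inequality they have finite measure.
  This justifies Fubini's theorem for a representing measure that may be infinite.\<close>

lemma sigma_finite_hyp_kernel:
  assumes [measurable_cong]: "sets \<nu> = sets dual_space"
    and fin: "(\<integral>\<^sup>+x. hyp_kernel v x \<partial>\<nu>) < \<infinity>"
  shows "sigma_finite_measure \<nu>"
proof
  define A where "A n = {x \<in> space \<nu>. 1 \<le> of_nat (Suc n) * ennreal (hyp_kernel v x)}" for n
  have [measurable]: "A n \<in> sets \<nu>" for n unfolding A_def by measurable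
  have "emeasure \<nu> (A n) < \<infinity>" for n
  proof -
    have "emeasure \<nu> (A n) \<le> of_nat (Suc n) * (\<integral>\<^sup>+x. ennreal (hyp_kernel v x) * indicator (space \<nu>) x \<partial>\<nu>)"
      unfolding A_def by (rule nn_integral_Markov_inequality) measurable
    also have "(\<integral>\<^sup>+x. ennreal (hyp_kernel v x) * indicator (space \<nu>) x \<partial>\<nu>) = (\<integral>\<^sup>+x. hyp_kernel v x \<partial>\<nu>)"
      by (intro nn_integral_cong) simp
    also have "of_nat (Suc n) * \<dots> < \<infinity>"
      using fin by (simp add: ennreal_mult_less_top ennreal_of_nat_eq_real_of_nat del: of_nat_Suc)
    finally show ?thesis .
  qed
  moreover have "(\<Union>n. A n) = space \<nu>"
  proof -
    have "\<exists>n. x \<in> A n" if "x \<in> space \<nu>" for x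
    proof -
      obtain n where "1 / hyp_kernel v x \<le> real n" using real_arch_simple by blast
      then have "1 \<le> real n * hyp_kernel v x"
        using hyp_kernel_pos[of v x, THEN less_imp_neq] by (simp add: field_simps)
      also have "\<dots> \<le> real (Suc n) * hyp_kernel v x"
        by (intro mult_right_mono) auto
      finally have "1 \<le> real (Suc n) * hyp_kernel v x" .
      then have "ennreal 1 \<le> ennreal (real (Suc n) * hyp_kernel v x)" by (rule ennreal_leI)
      then have "1 \<le> of_nat (Suc n) * ennreal (hyp_kernel v x)"
        by (simp add: ennreal_mult ennreal_of_nat_eq_real_of_nat del: of_nat_Suc)
      then show ?thesis using that by (auto simp: A_def)
    qed
    then show ?thesis by (auto simp: A_def)
  qed
  ultimately show "\<exists>A. countable A \<and> A \<subseteq> sets \<nu> \<and> \<Union> A = space \<nu> \<and> (\<forall>a\<in>A. emeasure \<nu> a \<noteq> \<infinity>)"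
    by (intro exI[of _ "range A"]) (auto simp: less_top)
qed

text \<open>Fubini's theorem moves the integral over \<open>h\<close> inside the representation of
  \<open>g\<close>. What remains is a mixture over \<nu> of the functions belonging to single points
  \<open>x\<close>.\<close>

lemma hyp_laplace_cosh_mixture:
  fixes w :: "'n::{finite,linorder} \<Rightarrow> real" and g :: "real ^ 'n::{finite,linorder} \<Rightarrow> ennreal"
  assumes w: "\<And>i. 0 < w i"
    and \<nu>: "sets \<nu> = sets dual_space" "(\<integral>\<^sup>+x. hyp_kernel (\<chi> i. 1) x \<partial>\<nu>) < \<infinity>"
    and g: "\<And>h. g h = (\<integral>\<^sup>+x. hyp_kernel (\<chi> i. exp (h $ i)) x \<partial>\<nu>)"
  shows "hyp_laplace (\<lambda>v :: real ^ 'n::{finite,linorder}. \<integral>\<^sup>+h. ennreal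
    (exp (- (\<delta> + (\<Sum>i\<in>UNIV. w i * cosh (h $ i + ln (v $ i)))))) * g h \<partial>lborel)"
proof -
  note [measurable_cong] = \<nu>(1)
  interpret \<nu>: sigma_finite_measure \<nu> by (rule sigma_finite_hyp_kernel[OF \<nu>])
  interpret L: pair_sigma_finite "lborel :: (real ^ 'n::{finite,linorder}) measure" \<nu> ..
  have [measurable]: "(\<lambda>z :: (real ^ 'n::{finite,linorder}) \<times> 'z. fst z $ i) \<in> borel_measurable (lborel \<Otimes>\<^sub>M M)"
    for i and M :: "'z measure"
    by (rule measurable_compose[OF measurable_fst]) simp
  have m0: "(\<lambda>(h :: real ^ 'n::{finite,linorder}, x). hyp_kernel (\<chi> i. exp (h $ i)) x)
      \<in> borel_measurable (lborel \<Otimes>\<^sub>M dual_space)"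
  proof -
    have "(\<lambda>h :: real ^ 'n::{finite,linorder}. hyp_var (\<chi> i. exp (h $ i)) e) \<in> borel_measurable lborel" for e
      by (cases e) (auto simp: hyp_var_def case_prod_unfold)
    note [measurable] = this
    have [measurable]: "(\<lambda>z :: (real ^ 'n::{finite,linorder}) \<times> _. dual_coord e (snd z))
        \<in> borel_measurable (lborel \<Otimes>\<^sub>M dual_space)" if "e \<in> hyp_index" for e
      using measurable_compose[OF measurable_snd measurable_dual_coord[OF that]] .
    show ?thesis
      unfolding hyp_kernel_eq case_prod_unfold by measurable
  qed
  then have [measurable]: "(\<lambda>z :: (real ^ 'n::{finite,linorder}) \<times> _. hyp_kernel (\<chi> i. exp (fst z $ i)) (snd z))
      \<in> borel_measurable (lborel \<Otimes>\<^sub>M \<nu>)"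
    by (simp add: case_prod_unfold cong: measurable_cong_sets sets_pair_measure_cong)
  have m: "(\<lambda>(h, x). ennreal (exp (- (\<delta> + (\<Sum>i\<in>UNIV. w i * cosh (h $ i + ln (v $ i))))) *
      hyp_kernel (\<chi> i. exp (h $ i)) x)) \<in> borel_measurable (lborel \<Otimes>\<^sub>M \<nu>)"
    for v :: "real ^ 'n::{finite,linorder}"
    unfolding case_prod_unfold by measurable
  have eq: "(\<integral>\<^sup>+h. ennreal (exp (- (\<delta> + (\<Sum>i\<in>UNIV. w i * cosh (h $ i + ln (v $ i)))))) * g h \<partial>lborel) =
    (\<integral>\<^sup>+x. \<integral>\<^sup>+h. ennreal (exp (- (\<delta> + (\<Sum>i\<in>UNIV. w i * cosh (h $ i + ln (v $ i))))) *
      hyp_kernel (\<chi> i. exp (h $ i)) x) \<partial>lborel \<partial>\<nu>)" for v :: "real ^ 'n::{finite,linorder}"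
  proof -
    have "ennreal (exp (- (\<delta> + (\<Sum>i\<in>UNIV. w i * cosh (h $ i + ln (v $ i)))))) * g h =
       (\<integral>\<^sup>+x. ennreal (exp (- (\<delta> + (\<Sum>i\<in>UNIV. w i * cosh (h $ i + ln (v $ i))))) *
        hyp_kernel (\<chi> i. exp (h $ i)) x) \<partial>\<nu>)" for h
      unfolding g ennreal_mult'[OF exp_ge_zero] by (rule nn_integral_cmult[symmetric]) measurable
    then show ?thesis
      using L.Fubini'[OF m[of v]] by simp
  qed
  show ?thesis
    unfolding eq
  proof (rule hyp_laplace_mixture)
    show "(\<lambda>x. \<integral>\<^sup>+h. ennreal (exp (- (\<delta> + (\<Sum>i\<in>UNIV. w i * cosh (h $ i + ln (v $ i))))) *
      hyp_kernel (\<chi> i. exp (h $ i)) x) \<partial>lborel) \<in> borel_measurable \<nu>" for v :: "real ^ 'n::{finite,linorder}"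
      using measurable_pair_swap[OF m[of v]]
      by (intro lborel.borel_measurable_nn_integral) (simp add: case_prod_unfold)
    show "hyp_laplace (\<lambda>v :: real ^ 'n::{finite,linorder}. \<integral>\<^sup>+h. ennreal (exp (- (\<delta> + (\<Sum>i\<in>UNIV. w i * cosh (h $ i + ln (v $ i))))) *
      hyp_kernel (\<chi> i. exp (h $ i)) x) \<partial>lborel)" if "x \<in> space \<nu>" for x
      using that sets_eq_imp_space_eq[OF \<nu>(1)] by (intro hyp_laplace_cosh_hyp_kernel w) simp
  qed
qed

subsection \<open>The Laplace transform\<close>

definition exp_vec :: "real ^ 'n \<Rightarrow> real ^ 'n" where
  "exp_vec a = (\<chi> i. exp (a $ i))"

lemma exp_vec_nth [simp]: "exp_vec a $ i = exp (a $ i)"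
  by (simp add: exp_vec_def)

lemma exp_vec_in_pos_orthant [simp]: "exp_vec a \<in> pos_orthant"
  by (simp add: pos_orthant_def)

lemma measurable_exp_vec [measurable]: "exp_vec \<in> borel_measurable borel"
  unfolding exp_vec_def[abs_def]
  by (intro borel_measurable_continuous_onI continuous_on_vec_lambda continuous_intros)

text \<open>The Laplace integrand in logarithmic coordinates; the last product is the Jacobian of
  \<open>exp_vec\<close>.\<close>

definition log_density :: "(real ^ 'n \<Rightarrow> real) \<Rightarrow> real ^ 'n \<Rightarrow> real ^ 'n \<Rightarrow> real" where
  "log_density f s a =
    exp (- (\<Sum>i\<in>UNIV. s $ i * exp (a $ i))) * f (exp_vec a) * (\<Prod>i\<in>UNIV. exp (a $ i))"

context
  fixes f :: "real ^ 'n::{finite,linorder} \<Rightarrow> real"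
  assumes nonneg: "\<And>x. x \<in> pos_orthant \<Longrightarrow> 0 \<le> f x"
    and integrable: "set_integrable lborel pos_orthant f"
begin

lemma log_density_nonneg: "0 \<le> log_density f s a"
  unfolding log_density_def by (intro mult_nonneg_nonneg prod_nonneg nonneg) auto

text \<open>The hypotheses control \<open>f\<close> only on the orthant, and \<open>exp_vec\<close>
  takes its values there, so the composition removes the indicator.\<close>

lemma measurable_f_exp_vec [measurable]: "(\<lambda>a. f (exp_vec a)) \<in> borel_measurable borel"
proof -
  have "(\<lambda>x. indicator pos_orthant x *\<^sub>R f x) \<in> borel_measurable borel"
    using integrable by (auto simp: set_integrable_def)
  from measurable_compose[OF measurable_exp_vec this] show ?thesis by simp
qed

lemma measurable_log_density [measurable]: "log_density f s \<in> borel_measurable borel"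
  unfolding log_density_def[abs_def] by measurable

lemma laplace_transform_nonneg: "0 \<le> laplace_transform f s"
  unfolding laplace_transform_def set_lebesgue_integral_def
  by (intro Bochner_Integration.integral_nonneg) (auto simp: indicator_def nonneg)

lemma laplace_transform_eq_nn_integral:
  assumes s: "s \<in> pos_orthant"
  shows "ennreal (laplace_transform f s) = (\<integral>\<^sup>+a. log_density f s a \<partial>lborel)"
proof -
  define f0 where "f0 x = indicator pos_orthant x * f x" for x
  have f0: "integrable lborel f0"
    using integrable by (simp add: set_integrable_def f0_def[abs_def])
  then have [measurable]: "f0 \<in> borel_measurable borel" by auto
  define e where "e x = exp (- (\<Sum>i\<in>UNIV. s $ i * x $ i))" for x :: "real ^ 'n::{finite,linorder}"
  have [measurable]: "e \<in> borel_measurable borel" unfolding e_def[abs_def] by measurable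
  have e1: "0 \<le> e x" "x \<in> pos_orthant \<Longrightarrow> e x \<le> 1" for x
  proof -
    show "0 \<le> e x" by (simp add: e_def)
    assume "x \<in> pos_orthant"
    then have "0 \<le> (\<Sum>i\<in>UNIV. s $ i * x $ i)"
      using s by (intro sum_nonneg mult_nonneg_nonneg) (auto simp: pos_orthant_def less_imp_le)
    then show "e x \<le> 1" by (simp add: e_def)
  qed
  have int: "integrable lborel (\<lambda>x. e x * f0 x)"
  proof (rule Bochner_Integration.integrable_bound[OF f0])
    show "AE x in lborel. norm (e x * f0 x) \<le> norm (f0 x)"
    proof (rule AE_I2)
      fix x
      show "norm (e x * f0 x) \<le> norm (f0 x)"
        using e1[of x] by (cases "x \<in> pos_orthant") (auto simp: f0_def abs_mult intro: mult_left_le_one_le)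
    qed
  qed measurable
  have "ennreal (laplace_transform f s) = ennreal (\<integral>x. e x * f0 x \<partial>lborel)"
    unfolding laplace_transform_def set_lebesgue_integral_def f0_def e_def
    by (intro arg_cong[where f=ennreal] Bochner_Integration.integral_cong) (auto simp: mult_ac)
  also have "\<dots> = (\<integral>\<^sup>+x. e x * f0 x \<partial>lborel)"
    using int e1(1) nonneg
    by (intro nn_integral_eq_integral[symmetric]) (auto simp: f0_def indicator_def)
  also have "\<dots> = (\<integral>\<^sup>+x. ennreal (e x * f0 x) * indicator pos_orthant x \<partial>lborel)"
    by (intro nn_integral_cong) (auto simp: f0_def indicator_def)
  also have "\<dots> = (\<integral>\<^sup>+a. ennreal (e (exp_vec a) * f0 (exp_vec a)) * ennreal (\<Prod>i\<in>UNIV. exp (a $ i)) \<partial>lborel)"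
    unfolding exp_vec_def by (rule nn_integral_pos_orthant_exp) measurable
  also have "\<dots> = (\<integral>\<^sup>+a. log_density f s a \<partial>lborel)"
    by (simp add: log_density_def f0_def e_def prod_nonneg flip: ennreal_mult'')
  finally show ?thesis .
qed

end

section \<open>The product of two Laplace integrands in the variables \<open>c\<close> and
  \<open>h\<close>\<close>

lemma exp_cosh_product:
  fixes u v a h :: real
  assumes "0 < v"
  shows "u * v * exp (a + h) + u / v * exp (a - h) = 2 * u * exp a * cosh (h + ln v)"
  using assms by (simp add: cosh_def exp_add exp_minus exp_diff field_simps)

text \<open>By \<open>exp_cosh_product\<close>, \<open>v\<close> enters the Laplace kernels only as
  a shift of \<open>h $ i\<close> by \<open>ln (v $ i)\<close>, and it leaves the factors with
  \<open>f\<close> altogether. The two Jacobians multiply to a factor depending on \<open>c\<close>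
  alone.\<close>

lemma log_density_product:
  fixes f :: "real ^ 'n::{finite,linorder} \<Rightarrow> real"
  assumes "v \<in> pos_orthant"
  shows "log_density f (\<chi> i. u $ i * v $ i) (c + h) * log_density f (\<chi> i. u $ i / v $ i) (c - h) =
    exp (- (- 2 * (\<Sum>i\<in>UNIV. c $ i) + (\<Sum>i\<in>UNIV. 2 * u $ i * exp (c $ i) * cosh (h $ i + ln (v $ i))))) *
    (f (\<chi> i. exp_vec c $ i * exp_vec h $ i) * f (\<chi> i. exp_vec c $ i / exp_vec h $ i))"
proof -
  have v: "0 < v $ i" for i using assms by (simp add: pos_orthant_def)
  have 1: "exp_vec (c + h) = (\<chi> i. exp_vec c $ i * exp_vec h $ i)"
    "exp_vec (c - h) = (\<chi> i. exp_vec c $ i / exp_vec h $ i)"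
    by (simp_all add: vec_eq_iff exp_add exp_diff)
  have 2: "(\<Prod>i\<in>UNIV. exp ((c + h) $ i)) * (\<Prod>i\<in>UNIV. exp ((c - h) $ i)) = exp (2 * (\<Sum>i\<in>UNIV. c $ i))"
    by (simp add: exp_sum[symmetric] exp_add[symmetric] sum.distrib[symmetric] sum_distrib_left
        flip: sum.distrib)
  have 3: "(\<Sum>i\<in>UNIV. (\<chi> i. u $ i * v $ i) $ i * exp ((c + h) $ i)) +
      (\<Sum>i\<in>UNIV. (\<chi> i. u $ i / v $ i) $ i * exp ((c - h) $ i)) =
      (\<Sum>i\<in>UNIV. 2 * u $ i * exp (c $ i) * cosh (h $ i + ln (v $ i)))"
    unfolding sum.distrib[symmetric]
    by (simp only: vec_lambda_beta vector_add_component vector_minus_component exp_cosh_product[OF v])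
  have "exp (- (- 2 * (\<Sum>i\<in>UNIV. c $ i) + (\<Sum>i\<in>UNIV. 2 * u $ i * exp (c $ i) * cosh (h $ i + ln (v $ i))))) =
    exp (- (\<Sum>i\<in>UNIV. (\<chi> i. u $ i * v $ i) $ i * exp ((c + h) $ i))) *
    exp (- (\<Sum>i\<in>UNIV. (\<chi> i. u $ i / v $ i) $ i * exp ((c - h) $ i))) *
    ((\<Prod>i\<in>UNIV. exp ((c + h) $ i)) * (\<Prod>i\<in>UNIV. exp ((c - h) $ i)))"
    unfolding 2 3[symmetric] by (simp flip: exp_add)
  then show ?thesis
    unfolding log_density_def 1 by simp
qed

theorem theorem1:
  fixes f :: "real ^ 'n::{finite,linorder} \<Rightarrow> real"
  assumes "prob_density_on_orthant f"
    and "mvhcm f"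
  shows "mvhcm (laplace_transform f)"
proof -
  have nonneg: "\<And>x. x \<in> pos_orthant \<Longrightarrow> 0 \<le> f x" and int: "set_integrable lborel pos_orthant f"
    using assms(1) by (auto simp: prob_density_on_orthant_def)
  note [measurable] = measurable_log_density[OF nonneg int] measurable_f_exp_vec[OF nonneg int]
  note F_nonneg = laplace_transform_nonneg[OF nonneg int]
  let ?K = "ennreal (2 ^ DIM(real ^ 'n::{finite,linorder}))"
  have "\<exists>\<nu>. sets \<nu> = sets dual_space \<and>
        (\<forall>v\<in>pos_orthant. has_bochner_integral \<nu> (hyp_kernel v)
             (laplace_transform f (\<chi> i. u $ i * v $ i) * laplace_transform f (\<chi> i. u $ i / v $ i)))"
    if u: "u \<in> pos_orthant" for u :: "real ^ 'n::{finite,linorder}"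
  proof -
    define uv where "uv v = (\<chi> i. u $ i * v $ i)" for v :: "real ^ 'n::{finite,linorder}"
    define u_v where "u_v v = (\<chi> i. u $ i / v $ i)" for v :: "real ^ 'n::{finite,linorder}"
    have pos: "uv v \<in> pos_orthant" "u_v v \<in> pos_orthant" if "v \<in> pos_orthant" for v
      using that u by (auto simp: uv_def u_v_def pos_orthant_def)
    have up: "0 < u $ i" for i using u by (simp add: pos_orthant_def)
    define W where "W v a b = ennreal (log_density f (uv v) a) * ennreal (log_density f (u_v v) b)" for v a b
    have W [measurable]: "case_prod (W v) \<in> borel_measurable (borel \<Otimes>\<^sub>M borel)" for v
      unfolding W_def case_prod_unfold by measurable
    have prod_eq: "ennreal (laplace_transform f (uv v) * laplace_transform f (u_v v)) =
        (\<integral>\<^sup>+c. \<integral>\<^sup>+h. ?K * W v (c + h) (c - h) \<partial>lborel \<partial>lborel)" if "v \<in> pos_orthant" for v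
    proof -
      have "ennreal (laplace_transform f (uv v) * laplace_transform f (u_v v)) =
          (\<integral>\<^sup>+a. log_density f (uv v) a \<partial>lborel) * (\<integral>\<^sup>+b. log_density f (u_v v) b \<partial>lborel)"
        using F_nonneg pos[OF that]
        by (simp add: ennreal_mult laplace_transform_eq_nn_integral[OF nonneg int])
      also have "\<dots> = (\<integral>\<^sup>+a. \<integral>\<^sup>+b. W v a b \<partial>lborel \<partial>lborel)"
        unfolding W_def by (simp add: nn_integral_cmult nn_integral_multc)
      also have "\<dots> = (\<integral>\<^sup>+c. \<integral>\<^sup>+h. ?K * W v (c + h) (c - h) \<partial>lborel \<partial>lborel)"
        by (rule nn_integral_sum_difference) measurable
      finally show ?thesis .
    qed
    have "hyp_laplace (\<lambda>v. \<integral>\<^sup>+c. \<integral>\<^sup>+h. ?K * W v (c + h) (c - h) \<partial>lborel \<partial>lborel)"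
    proof (rule hyp_laplace_mixture)
      fix v :: "real ^ 'n::{finite,linorder}"
      have [measurable]: "(\<lambda>z. W v (fst z + snd z) (fst z - snd z)) \<in> borel_measurable (lborel \<Otimes>\<^sub>M lborel)"
        unfolding W_def by measurable
      show "(\<lambda>c. \<integral>\<^sup>+h. ?K * W v (c + h) (c - h) \<partial>lborel) \<in> borel_measurable lborel"
        by (intro lborel.borel_measurable_nn_integral) (simp add: case_prod_unfold)
    next
      fix c :: "real ^ 'n::{finite,linorder}"
      \<comment> \<open>The hypothesis is used at the point \<open>exp_vec c\<close>. The measure
        depends on \<open>c\<close> in an uncontrolled way, which \<open>hyp_laplace_mixture\<close>
        tolerates.\<close>
      obtain \<nu> where \<nu>: "sets \<nu> = sets dual_space"
        and bi: "\<And>v. v \<in> pos_orthant \<Longrightarrow> has_bochner_integral \<nu> (hyp_kernel v)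
          (f (\<chi> i. exp_vec c $ i * v $ i) * f (\<chi> i. exp_vec c $ i / v $ i))"
        using assms(2) exp_vec_in_pos_orthant[of c] unfolding mvhcm_def by blast
      define g where "g h = ennreal (f (\<chi> i. exp_vec c $ i * exp_vec h $ i) * f (\<chi> i. exp_vec c $ i / exp_vec h $ i))"
        for h :: "real ^ 'n::{finite,linorder}"
      have nn: "(\<integral>\<^sup>+x. hyp_kernel v x \<partial>\<nu>) =
          ennreal (f (\<chi> i. exp_vec c $ i * v $ i) * f (\<chi> i. exp_vec c $ i / v $ i))" if "v \<in> pos_orthant" for v
        using bi[OF that] by (subst nn_integral_eq_integral) (auto simp: has_bochner_integral_iff)
      \<comment> \<open>The factors free of \<open>h\<close> and \<open>v\<close> are moved into the
        exponent: the Jacobians from \<open>log_density_product\<close> and the power of 2 from the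
        change to \<open>c\<close> and \<open>h\<close>.\<close>
      define \<delta> where "\<delta> = - 2 * (\<Sum>i\<in>UNIV. c $ i) - real DIM(real ^ 'n::{finite,linorder}) * ln 2"
      show "hyp_laplace (\<lambda>v. \<integral>\<^sup>+h. ?K * W v (c + h) (c - h) \<partial>lborel)"
      proof (rule hyp_laplace_cong)
        show "hyp_laplace (\<lambda>v. \<integral>\<^sup>+h. ennreal (exp (- (\<delta> + (\<Sum>i\<in>UNIV. (2 * u $ i * exp (c $ i)) *
            cosh (h $ i + ln (v $ i)))))) * g h \<partial>lborel)"
        proof (rule hyp_laplace_cosh_mixture[OF _ \<nu>])
          show "(\<integral>\<^sup>+x. hyp_kernel (\<chi> i. 1) x \<partial>\<nu>) < \<infinity>" by (simp add: nn)
          show "g h = (\<integral>\<^sup>+x. hyp_kernel (\<chi> i. exp (h $ i)) x \<partial>\<nu>)" for h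
            unfolding exp_vec_def[symmetric] by (simp add: nn g_def)
        qed (simp add: up)
        fix v :: "real ^ 'n::{finite,linorder}" assume v: "v \<in> pos_orthant"
        show "(\<integral>\<^sup>+h. ennreal (exp (- (\<delta> + (\<Sum>i\<in>UNIV. (2 * u $ i * exp (c $ i)) *
            cosh (h $ i + ln (v $ i)))))) * g h \<partial>lborel) = (\<integral>\<^sup>+h. ?K * W v (c + h) (c - h) \<partial>lborel)"
        proof (rule nn_integral_cong)
          fix h :: "real ^ 'n::{finite,linorder}"
          have K: "2 ^ DIM(real ^ 'n::{finite,linorder}) = exp (real DIM(real ^ 'n::{finite,linorder}) * ln (2 :: real))"
            by (simp add: exp_of_nat_mult)
          have ex: "exp (- (- 2 * p - q + r)) = exp q * exp (- (- 2 * p + r))" for p q r :: real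
            by (simp flip: exp_add)
          have W_eq: "W v (c + h) (c - h) = ennreal (exp (- (- 2 * (\<Sum>i\<in>UNIV. c $ i) +
            (\<Sum>i\<in>UNIV. 2 * u $ i * exp (c $ i) * cosh (h $ i + ln (v $ i)))))) * g h"
            unfolding W_def uv_def u_v_def g_def
            by (simp only: log_density_product[OF v] ennreal_mult'[OF exp_ge_zero, symmetric]
                ennreal_mult'[OF log_density_nonneg[OF nonneg int], symmetric])
          show "ennreal (exp (- (\<delta> + (\<Sum>i\<in>UNIV. (2 * u $ i * exp (c $ i)) *
            cosh (h $ i + ln (v $ i)))))) * g h = ?K * W v (c + h) (c - h)"
            by (simp only: W_eq K \<delta>_def ex ennreal_mult'[OF exp_ge_zero] mult.assoc)
        qed
      qed
    qed
    \<comment> \<open>At \<open>v = 1\<close> the double integral is the square of the Laplace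
      transform at \<open>u\<close>, a real number; this is the premise in
      \<open>hyp_laplace\<close>.\<close>
    moreover have "(\<integral>\<^sup>+c. \<integral>\<^sup>+h. ?K * W (\<chi> i. 1) (c + h) (c - h) \<partial>lborel \<partial>lborel) < \<infinity>"
      by (subst prod_eq[symmetric]) auto
    ultimately obtain \<nu> where \<nu>: "sets \<nu> = sets dual_space"
      and eq: "\<And>v. v \<in> pos_orthant \<Longrightarrow>
        (\<integral>\<^sup>+c. \<integral>\<^sup>+h. ?K * W v (c + h) (c - h) \<partial>lborel \<partial>lborel) = (\<integral>\<^sup>+x. hyp_kernel v x \<partial>\<nu>)"
      unfolding hyp_laplace_def by blast
    note [measurable_cong] = \<nu>
    \<comment> \<open>The common value is a nonnegative real, so the equation in extended reals also
      yields integrability.\<close>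
    have "has_bochner_integral \<nu> (hyp_kernel v) (laplace_transform f (uv v) * laplace_transform f (u_v v))"
      if "v \<in> pos_orthant" for v
      using eq[OF that] prod_eq[OF that] F_nonneg
      by (intro has_bochner_integral_nn_integral) auto
    then show ?thesis
      using \<nu> unfolding uv_def u_v_def by blast
  qed
  then show ?thesis
    unfolding mvhcm_def using F_nonneg by blast
qed

end
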